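(* Fix integers $n\geq 2$ and $k\geq 3$ with $k\leq n+1$. Let $\gamma\geq 0$ satisfy $\gamma\geq\alpha_m(S^{n-1},k-1,1/2)$. Then $\alpha_m(\mathbb{R}^n,k)$ is at most the supremum of $M(f)$ over all continuous, radial functions $f\colon\mathbb{R}^n\to\mathbb{R}$ of positive type with $f(0)=1$ and $f(1)\leq\gamma$.
   Context: A unit $k$-simplex in $\mathbb{R}^n$ is a set of $k\leq n+1$ points with all pairwise distances equal to $1$. A set avoids unit $k$-simplices if no $k$ of its points form a unit $k$-simplex. The upper density of $X\subseteq\mathbb{R}^n$ is $\overline{\delta}(X)=\limsup_{T\to\infty}\operatorname{vol}(X\cap[-T,T]^n)/\operatorname{vol}[-T,T]^n$, and $\alpha_m(\mathbb{R}^n,k)$ is the supremum of $\overline{\delta}(I)$ over Lebesgue-measurable $I\subseteq\mathbb{R}^n$ avoiding unit $k$-simplices. On the sphere $S^{n-1}$ with normalized surface measure $\omega$ (total mass $1$), a $(k,t)$-simplex is a set of $k$ points with pairwise inner products $t$, and $\alpha_m(S^{n-1},k,t)$ is the supremum of $\omega(I)$ over measurable $I\subseteq S^{n-1}$ containing no $(k,t)$-simplex. A continuous $f\colon\mathbb{R}^n\to\mathbb{R}$ is of positive type if $(f(x-y))_{x,y\in U}$ is positive semidefinite for every finite $U\subseteq\mathbb{R}^n$; such $f$ has a well-defined mean value $M(f)=\lim_{T\to\infty}\frac{1}{\operatorname{vol}[-T,T]^n}\int_{[-T,T]^n}f(x)\,dx$. $f$ is radial if $f(x)$ depends only on $\|x\|$,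 and $f(r)$ denotes its common value on vectors of norm $r$. *)

theory Defs
  imports "HOL-Probability.Probability"
begin

definition unit_simplex :: "nat \<Rightarrow> (real^'n) set \<Rightarrow> bool" where
  "unit_simplex k S \<longleftrightarrow>
     finite S \<and> card S = k \<and> (\<forall>x\<in>S. \<forall>y\<in>S. x \<noteq> y \<longrightarrow> dist x y = 1)"

definition avoids_unit_simplices :: "nat \<Rightarrow> (real^'n) set \<Rightarrow> bool" where
  "avoids_unit_simplices k X \<longleftrightarrow> \<not> (\<exists>S\<subseteq>X. unit_simplex k S)"

definition cube :: "real \<Rightarrow> (real^'n) set" where
  "cube T = cbox (\<chi> i. - T) (\<chi> i. T)"

definition upper_density :: "(real^'n) set \<Rightarrow> ereal" where
  "upper_density X =
     Limsup at_top (\<lambda>T::real. ereal (measure lebesgue (X \<inter> cube T) / measure lebesgue (cube T :: (real^'n) set)))"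

text \<open>The argument of type \<open>'n itself\<close> only carries the dimension \<open>n = CARD('n)\<close>.\<close>

definition alpha_space :: "'n::finite itself \<Rightarrow> nat \<Rightarrow> ereal" where
  "alpha_space (_ :: 'n itself) k =
     (SUP I \<in> {I :: (real^'n) set. I \<in> sets lebesgue \<and> avoids_unit_simplices k I}. upper_density I)"

text \<open>The normalized surface measure of the unit sphere, in polar coordinates: the measure of a
  set \<open>A\<close> of unit vectors is the fraction of the volume of the unit ball filled by the
  segments from the origin to the points of \<open>A\<close>. It is completed, so that subsets of null sets are
  measurable, as for Lebesgue measure on the Euclidean space. The facts \<open>prob_space_sphere_measure\<close>
  and \<open>sphere_measure_orthogonal_image\<close> below show that its total mass is 1 and that it is invariant
  under the orthogonal group.\<close>

definition sphere_measure :: "(real^'n) measure" where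
  "sphere_measure =
     completion (restrict_space (distr (uniform_measure lborel (ball 0 1)) borel sgn) (sphere 0 1))"

definition sphere_simplex :: "nat \<Rightarrow> real \<Rightarrow> (real^'n) set \<Rightarrow> bool" where
  "sphere_simplex k t S \<longleftrightarrow>
     S \<subseteq> sphere 0 1 \<and> finite S \<and> card S = k \<and> (\<forall>x\<in>S. \<forall>y\<in>S. x \<noteq> y \<longrightarrow> x \<bullet> y = t)"

text \<open>The supremum is taken over a set of reals that contains \<open>measure sphere_measure {}\<close> whenever
  \<open>k > 0\<close> and is bounded above by 1.\<close>

definition alpha_sphere :: "'n::finite itself \<Rightarrow> nat \<Rightarrow> real \<Rightarrow> real" where
  "alpha_sphere (_ :: 'n itself) k t =
     (SUP I \<in> {I :: (real^'n) set. I \<in> sets sphere_measure \<and> \<not> (\<exists>S\<subseteq>I. sphere_simplex k t S)}.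
        measure sphere_measure I)"

definition positive_type :: "(real^'n \<Rightarrow> real) \<Rightarrow> bool" where
  "positive_type f \<longleftrightarrow>
     (\<forall>U. finite U \<longrightarrow>
        (\<forall>x\<in>U. \<forall>y\<in>U. f (x - y) = f (y - x)) \<and>
        (\<forall>c :: real^'n \<Rightarrow> real. (\<Sum>x\<in>U. \<Sum>y\<in>U. c x * c y * f (x - y)) \<ge> 0))"

definition radial :: "(real^'n \<Rightarrow> real) \<Rightarrow> bool" where
  "radial f \<longleftrightarrow> (\<forall>x y. norm x = norm y \<longrightarrow> f x = f y)"

definition mean_value :: "(real^'n \<Rightarrow> real) \<Rightarrow> real" where
  "mean_value f =
     Lim at_top (\<lambda>T::real. (LINT x:cube T|lebesgue. f x) / measure lebesgue (cube T :: (real^'n) set))"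

lemma space_sphere_measure: "space (sphere_measure :: (real^'n) measure) = sphere 0 1"
  by (simp add: sphere_measure_def space_restrict_space)

lemma emeasure_sphere_measure:
  fixes A :: "(real^'n) set"
  assumes "A \<in> sets borel" "A \<subseteq> sphere 0 1"
  shows "A \<in> sets sphere_measure"
    and "emeasure sphere_measure A =
           emeasure lborel (ball 0 1 \<inter> sgn -` A) / emeasure lborel (ball 0 1 :: (real^'n) set)"
proof -
  let ?D = "distr (uniform_measure lborel (ball 0 1)) borel sgn :: (real^'n) measure"
  have A: "A \<in> sets (restrict_space ?D (sphere 0 1))"
    using assms by (auto simp: sets_restrict_space)
  then show "A \<in> sets sphere_measure"
    by (simp add: sphere_measure_def)
  have pre: "sgn -` A \<in> sets (borel :: (real^'n) measure)"
    using measurable_sets[OF borel_measurable_sgn assms(1)] by simp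
  have "emeasure sphere_measure A = emeasure ?D A"
    using A assms by (simp add: sphere_measure_def emeasure_restrict_space)
  also have "\<dots> = emeasure (uniform_measure lborel (ball 0 1)) (sgn -` A)"
    using assms by (subst emeasure_distr) auto
  finally show "emeasure sphere_measure A =
      emeasure lborel (ball 0 1 \<inter> sgn -` A) / emeasure lborel (ball 0 1 :: (real^'n) set)"
    using pre by simp
qed

lemma prob_space_sphere_measure: "prob_space (sphere_measure :: (real^'n) measure)"
proof
  let ?B = "ball 0 1 :: (real^'n) set"
  have fin: "emeasure lborel ?B \<noteq> \<infinity>" "emeasure lborel ?B \<noteq> 0"
    using emeasure_bounded_finite[of ?B] content_ball_pos[of 1 "0 :: real^'n"]
    by (auto simp: measure_def)
  have "?B \<inter> sgn -` sphere 0 1 = ?B - {0}"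
    by (auto simp: norm_sgn)
  then have "emeasure lborel (?B \<inter> sgn -` sphere 0 1) = emeasure lborel ?B"
    using emeasure_Diff_null_set[of "{0}" lborel ?B] by (simp add: finite_imp_null_set_lborel)
  then show "emeasure sphere_measure (space sphere_measure :: (real^'n) set) = 1"
    using fin ennreal_divide_self[of "emeasure lborel ?B"]
    by (simp add: space_sphere_measure emeasure_sphere_measure(2) top.not_eq_extremum)
qed

lemma emeasure_lborel_isometry_vimage:
  fixes f :: "'a::euclidean_space \<Rightarrow> 'a"
  assumes lin: "linear f" and nrm: "\<And>x. norm (f x) = norm x" and A [measurable]: "A \<in> sets borel"
  shows "emeasure lborel (f -` A) = emeasure lborel A"
proof -
  define a :: "'a \<Rightarrow> ennreal" where "a = indicator A"
  define b :: "'a \<Rightarrow> ennreal" where "b = indicator (ball 0 1)"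
  have [measurable]: "a \<in> borel_measurable borel" "b \<in> borel_measurable borel"
    unfolding a_def b_def by (rule borel_measurable_indicator; simp)+
  have bf: "b (f x) = b x" for x
    by (simp add: b_def indicator_def nrm)
  have f_meas [measurable]: "f \<in> borel_measurable borel"
    using lin by (intro borel_measurable_continuous_onI linear_continuous_on)
      (simp add: linear_conv_bounded_linear)
  have fdiff: "f (x - y) = f x - f y" and fadd: "f (x + y) = f x + f y" for x y
    using lin by (simp_all add: linear_diff linear_add)
  have inj: "inj f"
  proof (rule injI)
    fix x y assume "f x = f y"
    then have "norm (x - y) = 0" using nrm[of "x - y"] by (simp add: fdiff)
    then show "x = y" by simp
  qed
  have surj: "surj f"
    using lin inj by (simp add: linear_inj_imp_surj)
  have shift: "(\<integral>\<^sup>+x. g (t + x) \<partial>lborel) = (\<integral>\<^sup>+x. g x \<partial>lborel)"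
    if [measurable]: "g \<in> borel_measurable borel" for g :: "'a \<Rightarrow> ennreal" and t
    by (subst (2) lborel_distr_plus[of t, symmetric]) (simp add: nn_integral_distr)
  have ia: "(\<integral>\<^sup>+x. a x \<partial>lborel) = emeasure lborel A"
    by (simp add: a_def)
  have ib: "(\<integral>\<^sup>+x. b x \<partial>lborel) = emeasure lborel (ball 0 1 :: 'a set)"
    by (simp add: b_def)
  have iaf: "(\<integral>\<^sup>+x. a (f x) \<partial>lborel) = emeasure lborel (f -` A)"
    using measurable_sets[OF f_meas A] by (simp add: a_def flip: indicator_vimage)
  have "(\<integral>\<^sup>+x. a (f x) \<partial>lborel) * (\<integral>\<^sup>+x. b x \<partial>lborel)
      = (\<integral>\<^sup>+x. a (f x) * (\<integral>\<^sup>+y. b (- f x + y) \<partial>lborel) \<partial>lborel)"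
    by (subst shift) (simp_all add: nn_integral_multc)
  also have "\<dots> = (\<integral>\<^sup>+x. (\<integral>\<^sup>+y. a (f x) * b (- f x + y) \<partial>lborel) \<partial>lborel)"
    by (intro nn_integral_cong nn_integral_cmult[symmetric]) measurable
  also have "\<dots> = (\<integral>\<^sup>+y. (\<integral>\<^sup>+x. a (f x) * b (- f x + y) \<partial>lborel) \<partial>lborel)"
    by (rule lborel_pair.Fubini'[symmetric]) measurable
  also have "\<dots> = (\<integral>\<^sup>+y. (\<integral>\<^sup>+x. a (f x + y) * b x \<partial>lborel) \<partial>lborel)"
  proof (rule nn_integral_cong)
    fix y
    obtain z where z: "y = f z" using surj by blast
    have bm: "b (- u) = b u" for u
      by (simp add: b_def indicator_def)
    have "(\<integral>\<^sup>+x. a (f x) * b (- f x + y) \<partial>lborel)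
        = (\<integral>\<^sup>+x. a (f (z + x)) * b (- f (z + x) + y) \<partial>lborel)"
      by (rule shift[symmetric]) measurable
    also have "\<dots> = (\<integral>\<^sup>+x. a (f x + y) * b x \<partial>lborel)"
      by (simp add: z fadd add.commute bm bf)
    finally show "(\<integral>\<^sup>+x. a (f x) * b (- f x + y) \<partial>lborel) = (\<integral>\<^sup>+x. a (f x + y) * b x \<partial>lborel)" .
  qed
  also have "\<dots> = (\<integral>\<^sup>+x. (\<integral>\<^sup>+y. a (f x + y) * b x \<partial>lborel) \<partial>lborel)"
    by (rule lborel_pair.Fubini') measurable
  also have "\<dots> = (\<integral>\<^sup>+x. (\<integral>\<^sup>+y. a y \<partial>lborel) * b x \<partial>lborel)"
    by (intro nn_integral_cong, subst nn_integral_multc) (simp_all add: shift)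
  also have "\<dots> = (\<integral>\<^sup>+x. a x \<partial>lborel) * (\<integral>\<^sup>+x. b x \<partial>lborel)"
    by (simp add: nn_integral_cmult)
  finally have "emeasure lborel (f -` A) * emeasure lborel (ball 0 1 :: 'a set)
      = emeasure lborel A * emeasure lborel (ball 0 1 :: 'a set)"
    by (simp only: ia ib iaf)
  moreover have "emeasure lborel (ball 0 1 :: 'a set) \<noteq> \<infinity>" "emeasure lborel (ball 0 1 :: 'a set) \<noteq> 0"
    using emeasure_bounded_finite[of "ball 0 1 :: 'a set"] content_ball_pos[of 1 "0 :: 'a"]
    by (auto simp: measure_def)
  ultimately show ?thesis
    by (metis ennreal_mult_cancel_left infinity_ennreal_def mult.commute)
qed
lemma sphere_measure_orthogonal_image:
  fixes f :: "real^'n \<Rightarrow> real^'n"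
  assumes f: "orthogonal_transformation f" and A: "A \<in> sets borel" "A \<subseteq> sphere 0 1"
  shows "f ` A \<in> sets sphere_measure"
    and "emeasure sphere_measure (f ` A) = emeasure sphere_measure A"
proof -
  define g where "g = inv f"
  have g: "orthogonal_transformation g"
    unfolding g_def by (rule orthogonal_transformation_inv[OF f])
  have lin: "linear g" and nrm: "norm (g x) = norm x" "norm (f x) = norm x" for x
    using f g by (auto simp: orthogonal_transformation)
  have sg: "sgn (g x) = g (sgn x)" for x
    using lin nrm by (simp add: sgn_div_norm linear_cmul)
  have pre: "sgn -` B \<in> sets borel" if "B \<in> sets borel" for B :: "(real^'n) set"
    using measurable_sets[OF borel_measurable_sgn that] by simp
  have "g \<in> borel_measurable borel"
    using lin by (intro borel_measurable_continuous_onI linear_continuous_on)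
      (simp add: linear_conv_bounded_linear)
  then have "g -` A \<in> sets borel"
    using measurable_sets[of g borel borel, OF _ A(1)] by simp
  moreover have im: "g -` A = f ` A"
    using orthogonal_transformation_bij[OF f] unfolding g_def
    by (metis bij_vimage_eq_inv_image bij_imp_bij_inv inv_inv_eq)
  ultimately have fA: "f ` A \<in> sets borel" "f ` A \<subseteq> sphere 0 1"
    using A(2) nrm by auto
  then show "f ` A \<in> sets sphere_measure"
    by (rule emeasure_sphere_measure(1))
  have "ball 0 1 \<inter> sgn -` (f ` A) = g -` (ball 0 1 \<inter> sgn -` A)"
    by (auto simp: sg nrm simp flip: im)
  then have "emeasure lborel (ball 0 1 \<inter> sgn -` (f ` A)) = emeasure lborel (ball 0 1 \<inter> sgn -` A)"
    using emeasure_lborel_isometry_vimage[OF lin nrm(1), of "ball 0 1 \<inter> sgn -` A"] pre[OF A(1)] by simp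
  then show "emeasure sphere_measure (f ` A) = emeasure sphere_measure A"
    using A fA by (simp add: emeasure_sphere_measure(2))
qed

end

theory Submission
  imports Defs
begin

text \<open>A compact subset \<open>K\<close> of the given set inside a large cube, repeated along a lattice with a
  margin, yields a closed periodic set \<open>P\<close> that still avoids unit \<open>k\<close>-simplices and has almost the
  same density. Its autocorrelation on the torus, divided by the density \<open>p\<close> of \<open>P\<close>, is continuous, of
  positive type, equals 1 at 0 and has mean value \<open>p\<close>. Averaging it over random isometries makes it
  radial. For \<open>y \<in> P\<close>, the unit vectors \<open>\<xi>\<close> with \<open>y + \<xi> \<in> P\<close> contain no \<open>(k - 1, 1/2)\<close>-simplex, since
  together with \<open>y\<close> it would give a unit \<open>k\<close>-simplex in \<open>P\<close>; this bounds the value at distance 1.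

  The random isometry is the Gram--Schmidt orthonormalisation of the rows of a random matrix whose
  distribution is invariant under rotation of the rows, which avoids Haar measure on the
  orthogonal group.\<close>

section \<open>Lattices and the torus\<close>

text \<open>A general set of positive upper density gives no direct hold on the mean of its
  autocorrelation. Periodicity does: the chance that a random point \<open>z\<close> of one period
  and \<open>z + x\<close> both lie in the set, averaged over \<open>x\<close>, is exactly the
  square of the density, by Fubini. Dividing by the value at 0, which is the density itself, leaves
  the density as the mean value. Closedness serves continuity: the overlap with a small shift
  converges by dominated convergence, without appeal to continuity of translations in mean. The
  margin keeps neighbouring copies from forming new simplices; it lowers the density only by a
  factor that tends to 1 as the cube grows. Averaging over isometries in general destroys
  periodicity, so the mean value has to be found again. It survives because cube means converge with
  an error bound that is the same for all isometries. For radiality it is enough that the random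
  matrix is invariant on one side.\<close>

definition lattice :: "real \<Rightarrow> (real^'n) set" where
  "lattice L = {v. \<forall>i. \<exists>m::int. v $ i = L * of_int m}"

text \<open>The half-open sides make the translates by \<open>lattice L\<close> tile the space
  exactly when \<open>L > 0\<close>. Centring at the origin puts the cube of half-width
  \<open>T\<close> inside once \<open>L = 2 * T + 2\<close>.\<close>

definition cell :: "real \<Rightarrow> (real^'n) set" where
  "cell L = {x. \<forall>i. - L / 2 \<le> x $ i \<and> x $ i < L / 2}"

text \<open>Normalised Lebesgue measure on a fundamental domain stands for the Haar measure of the
  quotient by \<open>lattice L\<close>. The quotient is never formed, so translation invariance is
  stated for periodic functions.\<close>

definition torus :: "real \<Rightarrow> (real^'n) measure" where
  "torus L = uniform_measure lborel (cell L)"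

lemma uminus_lattice: "v \<in> lattice L \<Longrightarrow> - v \<in> lattice L"
  unfolding lattice_def by (auto simp: ) (metis mult_minus_right of_int_minus)

lemma diff_lattice: "v \<in> lattice L \<Longrightarrow> w \<in> lattice L \<Longrightarrow> v - w \<in> lattice L"
  unfolding lattice_def by (auto simp: ) (metis right_diff_distrib of_int_diff)

lemma zero_lattice: "0 \<in> lattice L"
  unfolding lattice_def by (auto intro: exI[of _ 0])

lemma countable_lattice: "countable (lattice L :: (real^'n) set)"
proof -
  have "lattice L \<subseteq> range (\<lambda>m::int^'n. (\<chi> i. L * of_int (m $ i)) :: real^'n)"
  proof
    fix v :: "real^'n" assume "v \<in> lattice L"
    then have "\<forall>i. \<exists>m::int. v $ i = L * of_int m" by (simp add: lattice_def)
    then obtain m :: "'n \<Rightarrow> int" where m: "\<And>i. v $ i = L * of_int (m i)"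
      by metis
    have "v = (\<chi> i. L * of_int ((\<chi> i. m i) $ i))" by (simp add: vec_eq_iff m)
    then show "v \<in> range (\<lambda>m::int^'n. (\<chi> i. L * of_int (m $ i)) :: real^'n)" by blast
  qed
  then show ?thesis
    by (rule countable_subset) simp
qed

lemma closed_lattice: "closed (lattice L :: (real^'n) set)"
proof -
  have "lattice L = {v :: real^'n. \<forall>i. v $ i \<in> (\<lambda>m. L * m) ` (of_int ` UNIV)}"
    by (auto simp: lattice_def image_iff)
  moreover have "closed ((\<lambda>m::real. L * m) ` (of_int ` UNIV))"
    using closed_scaling[of "range of_int :: real set" L] closed_of_int_image[of UNIV] by simp
  ultimately show ?thesis
    by (simp only:) (intro closed_Collect_all closed_vimage[unfolded vimage_def] continuous_intros)
qed

text \<open>A coordinate \<open>a\<close> and an integer \<open>m\<close> satisfy the two half-open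
  inequalities exactly when \<open>m\<close> is \<open>a / L + 1/2\<close> rounded down, so the
  lattice vector is determined coordinate by coordinate.\<close>

lemma cell_tiling:
  assumes "L > 0" shows "\<exists>!v. v \<in> lattice L \<and> x - v \<in> (cell L :: (real^'n) set)"
proof -
  have key: "(- L / 2 \<le> a - L * of_int m \<and> a - L * of_int m < L / 2) \<longleftrightarrow> m = \<lfloor>a / L + 1/2\<rfloor>" for a and m :: int
  proof -
    have "(m = \<lfloor>a / L + 1/2\<rfloor>) \<longleftrightarrow> (of_int m \<le> a / L + 1/2 \<and> a / L + 1/2 < of_int m + 1)"
      by (metis floor_eq_iff)
    also have "\<dots> \<longleftrightarrow> (- L / 2 \<le> a - L * of_int m \<and> a - L * of_int m < L / 2)"
      using assms by (auto simp: field_simps)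
    finally show ?thesis ..
  qed
  show ?thesis
  proof (rule ex1I[of _ "\<chi> i. L * of_int \<lfloor>x $ i / L + 1/2\<rfloor>"])
    show "(\<chi> i. L * of_int \<lfloor>x $ i / L + 1/2\<rfloor>) \<in> lattice L \<and> x - (\<chi> i. L * of_int \<lfloor>x $ i / L + 1/2\<rfloor>) \<in> cell L"
      using key by (auto simp: lattice_def cell_def)
  next
    fix v assume v: "v \<in> lattice L \<and> x - v \<in> cell L"
    then have "\<forall>i. \<exists>m::int. v $ i = L * of_int m" by (simp add: lattice_def)
    then obtain m :: "'n \<Rightarrow> int" where m: "\<And>i. v $ i = L * of_int (m i)"
      by metis
    have "m i = \<lfloor>x $ i / L + 1/2\<rfloor>" for i
      using v key[of "x $ i" "m i"] by (simp add: cell_def m)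
    then show "v = (\<chi> i. L * of_int \<lfloor>x $ i / L + 1/2\<rfloor>)" by (simp add: vec_eq_iff m)
  qed
qed

lemma cell_borel [measurable]: "cell L \<in> sets (borel :: (real^'n) measure)"
  unfolding cell_def by measurable

section \<open>Integrals of periodic functions over one cell\<close>

lemma nn_integral_lborel_shift:
  fixes g :: "'a::euclidean_space \<Rightarrow> ennreal"
  assumes [measurable]: "g \<in> borel_measurable borel"
  shows "(\<integral>\<^sup>+x. g (x + t) \<partial>lborel) = (\<integral>\<^sup>+x. g x \<partial>lborel)"
  by (subst (2) lborel_distr_plus[of t, symmetric]) (simp add: nn_integral_distr add.commute)

text \<open>The tiling as a partition of unity: the integral counts the lattice vectors that carry
  \<open>x\<close> into the cell. The version with the plus sign comes from the symmetry of the
  lattice.\<close>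

lemma nn_integral_lattice_indicator_cell:
  fixes x :: "real^'n"
  assumes "L > 0"
  shows "(\<integral>\<^sup>+v. indicator (cell L) (x - v) \<partial>count_space (lattice L)) = 1"
    and "(\<integral>\<^sup>+v. indicator (cell L) (x + v) \<partial>count_space (lattice L)) = 1"
proof -
  from cell_tiling[OF assms, of x] obtain v0 where v0': "v0 \<in> lattice L \<and> x - v0 \<in> cell L"
    and un': "\<forall>v. v \<in> lattice L \<and> x - v \<in> cell L \<longrightarrow> v = v0"
    by (rule ex1E)
  note v0 = conjunct1[OF v0'] conjunct2[OF v0']
  have un: "v = v0" if "v \<in> lattice L" "x - v \<in> cell L" for v
    using un' that by blast
  have "(\<integral>\<^sup>+v. indicator (cell L) (x - v) \<partial>count_space (lattice L))
      = (\<integral>\<^sup>+v. indicator {v0} v \<partial>count_space (lattice L))"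
  proof (rule nn_integral_cong)
    fix v :: "real^'n" assume v: "v \<in> space (count_space (lattice L))"
    have "x - v \<in> cell L \<longleftrightarrow> v = v0" using un[of v] v v0 by auto
    then show "indicator (cell L) (x - v) = (indicator {v0} v :: ennreal)"
      by (simp add: indicator_def)
  qed
  then show "(\<integral>\<^sup>+v. indicator (cell L) (x - v) \<partial>count_space (lattice L)) = 1"
    using v0 by (subst (asm) nn_integral_indicator) auto
  have "(\<integral>\<^sup>+v. indicator (cell L) (x + v) \<partial>count_space (lattice L))
      = (\<integral>\<^sup>+v. indicator {-v0} v \<partial>count_space (lattice L))"
  proof (rule nn_integral_cong)
    fix v :: "real^'n" assume "v \<in> space (count_space (lattice L))"
    then have v: "v \<in> lattice L" by simp
    have "x + v \<in> cell L \<longleftrightarrow> v = - v0" using un[OF uminus_lattice[OF v]] v0 by auto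
    then show "indicator (cell L) (x + v) = (indicator {-v0} v :: ennreal)"
      by (simp add: indicator_def)
  qed
  then show "(\<integral>\<^sup>+v. indicator (cell L) (x + v) \<partial>count_space (lattice L)) = 1"
    using v0 uminus_lattice by (subst (asm) nn_integral_indicator) auto
qed

text \<open>The unfolding argument. A shifted cell is another fundamental domain: cut it along the
  tiling by the original cell, move each piece back by its lattice vector, under which
  \<open>h\<close> is unchanged, and reassemble. The lattice is countable and the integrands are
  nonnegative, so sum and integral may be exchanged.\<close>

lemma nn_integral_cell_shift:
  fixes h :: "real^'n \<Rightarrow> ennreal"
  assumes L: "L > 0" and [measurable]: "h \<in> borel_measurable borel"
    and per: "\<And>x v. v \<in> lattice L \<Longrightarrow> h (x + v) = h x"
  shows "(\<integral>\<^sup>+x. h (x + a) * indicator (cell L) x \<partial>lborel) = (\<integral>\<^sup>+x. h x * indicator (cell L) x \<partial>lborel)"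
proof -
  let ?Q = "cell L :: (real^'n) set" and ?C = "count_space (lattice L) :: (real^'n) measure"
  have "(\<integral>\<^sup>+x. h (x + a) * indicator ?Q x \<partial>lborel) = (\<integral>\<^sup>+x. h (x + a) * indicator ?Q (x + a - a) \<partial>lborel)"
    by simp
  also have "\<dots> = (\<integral>\<^sup>+x. h x * indicator ?Q (x - a) \<partial>lborel)"
    by (rule nn_integral_lborel_shift[of "\<lambda>x. h x * indicator ?Q (x - a)"]) measurable
  \<comment> \<open>The factor inserted here integrates to 1, since each \<open>x\<close> lies in
    exactly one translate of the cell.\<close>
  also have "\<dots> = (\<integral>\<^sup>+x. (\<integral>\<^sup>+v. h x * indicator ?Q (x - a) * indicator ?Q (x - v) \<partial>?C) \<partial>lborel)"
    by (simp add: nn_integral_cmult nn_integral_lattice_indicator_cell[OF L])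
  also have "\<dots> = (\<integral>\<^sup>+v. (\<integral>\<^sup>+x. h x * indicator ?Q (x - a) * indicator ?Q (x - v) \<partial>lborel) \<partial>?C)"
    by (rule nn_integral_count_space_nn_integral[OF countable_lattice]) measurable
  also have "\<dots> = (\<integral>\<^sup>+v. (\<integral>\<^sup>+x. h x * indicator ?Q x * indicator ?Q (x - a + v) \<partial>lborel) \<partial>?C)"
  proof (rule nn_integral_cong)
    fix v :: "real^'n" assume v: "v \<in> space ?C"
    have "(\<integral>\<^sup>+x. h x * indicator ?Q (x - a) * indicator ?Q (x - v) \<partial>lborel)
        = (\<integral>\<^sup>+x. h (x + v) * indicator ?Q (x + v - a) * indicator ?Q (x + v - v) \<partial>lborel)"
      by (rule nn_integral_lborel_shift[symmetric]) measurable
    also have "\<dots> = (\<integral>\<^sup>+x. h x * indicator ?Q x * indicator ?Q (x - a + v) \<partial>lborel)"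
      using v by (intro nn_integral_cong) (simp add: per algebra_simps)
    finally show "(\<integral>\<^sup>+x. h x * indicator ?Q (x - a) * indicator ?Q (x - v) \<partial>lborel)
        = (\<integral>\<^sup>+x. h x * indicator ?Q x * indicator ?Q (x - a + v) \<partial>lborel)" .
  qed
  also have "\<dots> = (\<integral>\<^sup>+x. (\<integral>\<^sup>+v. h x * indicator ?Q x * indicator ?Q (x - a + v) \<partial>?C) \<partial>lborel)"
    by (rule nn_integral_count_space_nn_integral[OF countable_lattice, symmetric]) measurable
  also have "\<dots> = (\<integral>\<^sup>+x. h x * indicator ?Q x \<partial>lborel)"
    by (simp add: nn_integral_cmult nn_integral_lattice_indicator_cell[OF L])
  finally show ?thesis .
qed

lemma cube_nth: "x \<in> cube T \<longleftrightarrow> (\<forall>i. \<bar>x $ i\<bar> \<le> T)"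
  by (auto simp: cube_def mem_box_cart abs_le_iff) (metis minus_le_iff)+

lemma measure_cube: "T \<ge> 0 \<Longrightarrow> measure lborel (cube T :: (real^'n) set) = (2 * T) ^ CARD('n)"
  unfolding cube_def by (subst content_cbox_cart) (auto simp: interval_ne_empty_cart)

lemma measure_cell:
  assumes "L > 0"
  shows "measure lborel (cell L :: (real^'n) set) = L ^ CARD('n)"
    and "emeasure lborel (cell L :: (real^'n) set) = ennreal (L ^ CARD('n))"
proof -
  let ?a = "(\<chi> i. - L / 2) :: real^'n" and ?b = "(\<chi> i. L / 2) :: real^'n"
  have "emeasure lborel (box ?a ?b) \<le> emeasure lborel (cell L :: (real^'n) set)"
    by (intro emeasure_mono) (auto simp: cell_def mem_box_cart less_imp_le)
  moreover have "emeasure lborel (cell L :: (real^'n) set) \<le> emeasure lborel (cbox ?a ?b)"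
    by (intro emeasure_mono) (auto simp: cell_def mem_box_cart less_imp_le)
  moreover have "emeasure lborel (box ?a ?b) = emeasure lborel (cbox ?a ?b)"
    by (simp add: emeasure_lborel_box_eq emeasure_lborel_cbox_eq)
  moreover have "emeasure lborel (cbox ?a ?b) = ennreal (L ^ CARD('n))"
  proof -
    have "measure lborel (cbox ?a ?b) = L ^ CARD('n)"
      using assms by (subst content_cbox_cart) (auto simp: interval_ne_empty_cart)
    then show ?thesis
      using emeasure_bounded_finite[of "cbox ?a ?b"] by (simp add: emeasure_eq_ennreal_measure)
  qed
  ultimately show e: "emeasure lborel (cell L :: (real^'n) set) = ennreal (L ^ CARD('n))"
    by order
  then show "measure lborel (cell L :: (real^'n) set) = L ^ CARD('n)"
    using assms by (simp add: measure_def)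
qed

lemma sets_torus [measurable_cong]: "sets (torus L) = sets borel"
  by (simp add: torus_def)

lemma space_torus [simp]: "space (torus L) = UNIV"
  by (simp add: torus_def)

lemma prob_space_torus: "L > 0 \<Longrightarrow> prob_space (torus L :: (real^'n) measure)"
  unfolding torus_def
  by (intro prob_space_uniform_measure) (simp_all add: measure_cell ennreal_zero_less_one)

lemma nn_integral_torus_shift:
  fixes h :: "real^'n \<Rightarrow> ennreal"
  assumes L: "L > 0" and [measurable]: "h \<in> borel_measurable borel"
    and per: "\<And>x v. v \<in> lattice L \<Longrightarrow> h (x + v) = h x"
  shows "(\<integral>\<^sup>+x. h (x + a) \<partial>torus L) = (\<integral>\<^sup>+x. h x \<partial>torus L)"
proof -
  have "(\<integral>\<^sup>+x. g x \<partial>torus L) = (\<integral>\<^sup>+x. g x * indicator (cell L) x \<partial>lborel) / emeasure lborel (cell L :: (real^'n) set)"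
    if [measurable]: "g \<in> borel_measurable borel" for g :: "real^'n \<Rightarrow> ennreal"
    unfolding torus_def by (rule nn_integral_uniform_measure) simp_all
  from this[of "\<lambda>x. h (x + a)"] this[of h] show ?thesis
    using nn_integral_cell_shift[OF assms(1,2,3), of a] by simp
qed

lemma integral_torus_shift:
  fixes h :: "real^'n \<Rightarrow> real"
  assumes L: "L > 0" and [measurable]: "h \<in> borel_measurable borel" and nn: "\<And>x. h x \<ge> 0"
    and per: "\<And>x v. v \<in> lattice L \<Longrightarrow> h (x + v) = h x"
  shows "(\<integral>x. h (x + a) \<partial>torus L) = (\<integral>x. h x \<partial>torus L)"
proof -
  have "(\<integral>\<^sup>+x. ennreal (h (x + a)) \<partial>torus L) = (\<integral>\<^sup>+x. ennreal (h x) \<partial>torus L)"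
    by (rule nn_integral_torus_shift[OF L, of "\<lambda>x. ennreal (h x)"]) (simp_all add: per)
  moreover have "(\<integral>x. g x \<partial>torus L) = enn2real (\<integral>\<^sup>+x. ennreal (g x) \<partial>torus L)"
    if [measurable]: "g \<in> borel_measurable borel" and "\<And>x. g x \<ge> 0" for g :: "real^'n \<Rightarrow> real"
    by (rule integral_eq_nn_integral) (simp_all add: that(2))
  from this[of "\<lambda>x. h (x + a)"] this[of h]
  have "(\<integral>x. h (x + a) \<partial>torus L) = enn2real (\<integral>\<^sup>+x. ennreal (h (x + a)) \<partial>torus L)"
    "(\<integral>x. h x \<partial>torus L) = enn2real (\<integral>\<^sup>+x. ennreal (h x) \<partial>torus L)"
    by (simp_all add: nn)
  ultimately show ?thesis by simp
qed

section \<open>Random isometries\<close>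

text \<open>Since \<open>sgn 0 = 0\<close>, the recursion is total: a vector that depends on its
  predecessors yields 0 rather than a unit vector. Orthogonality, equivariance and measurability
  therefore need no independence hypothesis.\<close>

fun gram_schmidt :: "(nat \<Rightarrow> 'a::real_inner) \<Rightarrow> nat \<Rightarrow> 'a" where
  "gram_schmidt m j = sgn (m j - (\<Sum>i\<in>set [0..<j]. (m j \<bullet> gram_schmidt m i) *\<^sub>R gram_schmidt m i))"

declare gram_schmidt.simps [simp del]

lemma gram_schmidt_orthogonal:
  assumes "i < j" shows "gram_schmidt m j \<bullet> gram_schmidt m i = 0"
  using assms
proof (induction j arbitrary: i rule: less_induct)
  case (less j)
  let ?u = "gram_schmidt m"
  have orth: "?u k \<bullet> ?u i = 0" if "k < j" "k \<noteq> i" for k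
    using less.IH[of k i] less.IH[of i k] that less.prems by (metis inner_commute linorder_neqE_nat)
  \<comment> \<open>Every output is a unit vector or 0. In the second case
    \<open>m j \<bullet> ?u i\<close> is 0 as well, so the projection sum has the right inner
    product with \<open>?u i\<close> in both cases.\<close>
  have nz: "?u i = 0 \<or> ?u i \<bullet> ?u i = 1"
    by (subst (1 2 3) gram_schmidt.simps) (auto simp: norm_sgn dot_square_norm sgn_zero_iff)
  have "(\<Sum>k<j. (m j \<bullet> ?u k) *\<^sub>R ?u k) \<bullet> ?u i = (\<Sum>k<j. if k = i then (m j \<bullet> ?u i) * (?u i \<bullet> ?u i) else 0)"
    unfolding inner_sum_left by (intro sum.cong) (auto simp: orth)
  also have "\<dots> = (m j \<bullet> ?u i) * (?u i \<bullet> ?u i)"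
    using less.prems by simp
  also have "\<dots> = m j \<bullet> ?u i"
    using nz by auto
  finally show ?case
    by (subst gram_schmidt.simps) (simp add: sgn_div_norm inner_diff_left atLeast0LessThan)
qed

text \<open>Orthonormalisation uses only linear combinations, inner products and norms, all of which
  \<open>q\<close> respects. A rotation of the random rows can therefore be read as a rotation of
  the frame.\<close>

lemma gram_schmidt_equivariant:
  assumes q: "orthogonal_transformation q"
  shows "gram_schmidt (\<lambda>i. q (m i)) j = q (gram_schmidt m j)"
proof (induction j rule: less_induct)
  case (less j)
  have lin: "linear q" and ip: "q x \<bullet> q y = x \<bullet> y" and nrm: "norm (q x) = norm x" for x y
    using q by (auto simp: orthogonal_transformation_def norm_eq_sqrt_inner)
  have "gram_schmidt (\<lambda>i. q (m i)) j
      = sgn (q (m j) - (\<Sum>i\<in>set [0..<j]. (q (m j) \<bullet> q (gram_schmidt m i)) *\<^sub>R q (gram_schmidt m i)))"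
    by (subst gram_schmidt.simps, intro arg_cong[where f=sgn] arg_cong2[where f="(-)"] sum.cong)
      (auto simp: less.IH)
  also have "\<dots> = sgn (q (m j - (\<Sum>i\<in>set [0..<j]. (m j \<bullet> gram_schmidt m i) *\<^sub>R gram_schmidt m i)))"
    using lin by (simp add: ip linear_diff linear_sum linear_cmul)
  also have "\<dots> = q (gram_schmidt m j)"
    using lin nrm by (subst (2) gram_schmidt.simps) (simp add: sgn_div_norm linear_cmul)
  finally show ?case .
qed

lemma borel_measurable_gram_schmidt:
  fixes m :: "'b \<Rightarrow> nat \<Rightarrow> 'a::euclidean_space"
  assumes [measurable]: "\<And>i. (\<lambda>x. m x i) \<in> borel_measurable M"
  shows "(\<lambda>x. gram_schmidt (m x) j) \<in> borel_measurable M"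
proof (induction j rule: less_induct)
  case (less j)
  have [measurable]: "(\<lambda>x. gram_schmidt (m x) i) \<in> borel_measurable M" if "i \<in> set [0..<j]" for i
    using less that by simp
  show ?case
    by (subst gram_schmidt.simps) measurable
qed

text \<open>The residual is a multiple of the output even when it is 0. Hence the outputs span at
  least what the inputs span, which excludes a degenerate frame for invertible matrices.\<close>

lemma gram_schmidt_span:
  "m j \<in> span (gram_schmidt m ` {..j})"
proof -
  let ?v = "m j - (\<Sum>i<j. (m j \<bullet> gram_schmidt m i) *\<^sub>R gram_schmidt m i)"
  have "gram_schmidt m j = sgn ?v"
    by (subst gram_schmidt.simps) (simp add: atLeast0LessThan)
  then have "?v = norm ?v *\<^sub>R gram_schmidt m j"
    by (cases "?v = 0") (simp_all add: sgn_div_norm)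
  then have "m j = norm ?v *\<^sub>R gram_schmidt m j + (\<Sum>i<j. (m j \<bullet> gram_schmidt m i) *\<^sub>R gram_schmidt m i)"
    by (simp add: algebra_simps)
  also have "\<dots> \<in> span (gram_schmidt m ` {..j})"
    by (intro span_add span_sum span_scale span_base) auto
  finally show ?thesis .
qed

section \<open>Isometries obtained from matrices\<close>

definition enum :: "nat \<Rightarrow> 'n::finite" where
  "enum = (SOME e. bij_betw e {0..<CARD('n)} UNIV)"

definition enum_index :: "'n::finite \<Rightarrow> nat" where
  "enum_index = inv_into {0..<CARD('n)} enum"

lemma bij_enum: "bij_betw enum {0..<CARD('n)} (UNIV :: 'n::finite set)"
  unfolding enum_def using ex_bij_betw_nat_finite[of "UNIV :: 'n set"] by (metis finite someI_ex)

lemma bij_enum_index: "bij_betw enum_index (UNIV :: 'n::finite set) {0..<CARD('n)}"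
  unfolding enum_index_def by (rule bij_betw_inv_into[OF bij_enum])

lemma enum_enum_index [simp]: "enum (enum_index i) = i"
  unfolding enum_index_def by (rule f_inv_into_f) (use bij_enum in \<open>auto simp: bij_betw_def\<close>)

text \<open>Orthonormalisation needs an order on the rows; the arbitrary enumeration of the index
  type supplies one, and no property below depends on which.\<close>

definition gs_row :: "real^'n^'n \<Rightarrow> 'n \<Rightarrow> real^'n" where
  "gs_row M i = gram_schmidt (\<lambda>j. M $ enum j) (enum_index i)"

text \<open>The coordinates of \<open>x\<close> in the orthonormalised frame. The map is linear for
  every \<open>M\<close> but an isometry only for \<open>M\<close> in \<open>gs_regular\<close>,
  hence the almost-everywhere statements below.\<close>

definition gs_apply :: "real^'n^'n \<Rightarrow> real^'n \<Rightarrow> real^'n" where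
  "gs_apply M x = (\<chi> i. gs_row M i \<bullet> x)"

definition gs_regular :: "(real^'n^'n) set" where
  "gs_regular = {M. \<forall>i. norm (gs_row M i) = 1}"

lemma gs_row_orthogonal: "i \<noteq> j \<Longrightarrow> gs_row M i \<bullet> gs_row M j = 0"
proof -
  assume "i \<noteq> j"
  then have "enum_index i \<noteq> enum_index j"
    using bij_enum_index by (metis enum_enum_index)
  then show ?thesis
    unfolding gs_row_def by (metis gram_schmidt_orthogonal inner_commute linorder_neqE_nat)
qed

lemma gs_row_equivariant:
  "orthogonal_transformation q \<Longrightarrow> gs_row (\<chi> i. q (M $ i)) i = q (gs_row M i)"
  unfolding gs_row_def using gram_schmidt_equivariant[of q "\<lambda>j. M $ enum j"] by simp

lemma borel_measurable_gs_row [measurable]: "(\<lambda>M. gs_row M i) \<in> borel_measurable borel"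
  unfolding gs_row_def
  by (rule borel_measurable_gram_schmidt) (intro borel_measurable_continuous_onI continuous_intros)

lemma gs_regular_borel [measurable]: "(gs_regular :: (real^'n^'n) set) \<in> sets borel"
  unfolding gs_regular_def by measurable

lemma gs_apply_isometry:
  assumes "M \<in> gs_regular"
  shows "orthogonal_transformation (gs_apply M)"
proof -
  have "orthogonal_matrix (\<chi> i. gs_row M i)"
    using assms gs_row_orthogonal
    by (auto simp: orthogonal_matrix_orthonormal_rows row_def gs_regular_def orthogonal_def vec_nth_inverse)
  moreover have "gs_apply M = (\<lambda>x. (\<chi> i. gs_row M i) *v x)"
    by (auto simp: gs_apply_def matrix_vector_mult_def inner_vec_def fun_eq_iff)
  ultimately show ?thesis
    by (simp add: orthogonal_transformation_matrix)
qed

lemma gs_row_span: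
  fixes M :: "real^'n^'n"
  shows "M $ i \<in> span (range (gs_row M))"
proof -
  have "M $ i = (\<lambda>j. M $ enum j) (enum_index i)" by simp
  also have "\<dots> \<in> span (gram_schmidt (\<lambda>j. M $ enum j) ` {..enum_index i})"
    by (rule gram_schmidt_span)
  also have "\<dots> \<subseteq> span (range (gs_row M))"
  proof (rule span_mono, rule image_subsetI)
    fix j assume "j \<in> {..enum_index i}"
    then have "j \<in> {0..<CARD('n)}"
      using bij_betwE[OF bij_enum_index, rule_format, of i] by simp
    then have "enum_index (enum j :: 'n) = j"
      unfolding enum_index_def using bij_enum by (metis bij_betw_def inv_into_f_f)
    then show "gram_schmidt (\<lambda>j. M $ enum j) j \<in> range (gs_row M)"
      unfolding gs_row_def by (metis rangeI)
  qed
  finally show ?thesis .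
qed

text \<open>If one frame vector vanished, the others, at most \<open>CARD('n) - 1\<close> many,
  would span every row of \<open>M\<close>; a nonzero vector orthogonal to all of them would lie in
  the kernel of \<open>M\<close>.\<close>

lemma det_nonzero_regular:
  fixes M :: "real^'n^'n"
  assumes "det M \<noteq> 0" shows "M \<in> gs_regular"
proof (rule ccontr)
  assume "M \<notin> gs_regular"
  then obtain i where "norm (gs_row M i) \<noteq> 1" by (auto simp: gs_regular_def)
  then have zero: "gs_row M i = 0"
    unfolding gs_row_def by (subst (asm) gram_schmidt.simps, subst gram_schmidt.simps) (auto simp: norm_sgn split: if_splits)
  have "gs_row M j \<in> span (gs_row M ` (UNIV - {i}))" for j
    by (cases "j = i") (auto simp: zero span_zero intro: span_base)
  then have "dim (range (gs_row M)) \<le> card (gs_row M ` (UNIV - {i}))"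
    by (intro dim_le_card) auto
  also have "\<dots> < CARD('n)"
    by (rule le_less_trans[OF card_image_le card_Diff1_less]) auto
  finally have "dim (range (gs_row M)) < DIM(real^'n)" by simp
  then obtain x where x: "x \<noteq> 0" "\<And>y. y \<in> span (range (gs_row M)) \<Longrightarrow> orthogonal x y"
    using orthogonal_to_subspace_exists by metis
  have "M *v x = 0"
    using x(2)[OF gs_row_span] by (auto simp: matrix_vector_mult_def vec_eq_iff orthogonal_def inner_vec_def mult.commute)
  with x(1) have "\<not> invertible M"
    using invertible_left_inverse matrix_left_invertible_ker by blast
  then show False using assms invertible_det_nz by blast
qed

text \<open>Lebesgue measure and the Euclidean norm on matrices are unchanged when an isometry acts
  on all rows, so a ball centred at 0 gives an invariant distribution. The radius is chosen to put
  the identity matrix inside, which makes the volume positive.\<close>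

definition frame_measure :: "(real^'n^'n) measure" where
  "frame_measure = uniform_measure lborel (gs_regular \<inter> ball 0 (norm (mat 1 :: real^'n^'n) + 1))"

lemma sets_frame_measure [measurable_cong]: "sets frame_measure = sets borel"
  by (simp add: frame_measure_def)

lemma space_frame_measure [simp]: "space frame_measure = UNIV"
  by (simp add: frame_measure_def)

lemma frame_set_emeasure:
  fixes G :: "(real^'n^'n) set"
  defines "G \<equiv> gs_regular \<inter> ball 0 (norm (mat 1 :: real^'n^'n) + 1)"
  shows "emeasure lborel G \<noteq> 0" "emeasure lborel G \<noteq> \<infinity>" "G \<in> sets borel"
proof -
  show [measurable]: "G \<in> sets borel" unfolding G_def by measurable
  have "emeasure lborel G \<le> emeasure lborel (ball 0 (norm (mat 1 :: real^'n^'n) + 1) :: (real^'n^'n) set)"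
    unfolding G_def by (intro emeasure_mono) auto
  then show "emeasure lborel G \<noteq> \<infinity>"
    using emeasure_bounded_finite[OF bounded_ball] by (metis infinity_ennreal_def leD less_top)
  define U :: "(real^'n^'n) set" where "U = {M. det M \<noteq> 0} \<inter> ball 0 (norm (mat 1 :: real^'n^'n) + 1)"
  have "continuous_on UNIV (\<lambda>M :: real^'n^'n. det M)"
    unfolding det_def by (intro continuous_intros)
  then have "open U"
    unfolding U_def by (intro open_Int open_Collect_neq) (auto intro: continuous_intros)
  moreover have "mat 1 \<in> U" by (simp add: U_def)
  ultimately have "emeasure lborel U \<noteq> 0"
    using open_not_negligible[of U] by (auto simp: negligible_iff_null_sets null_sets_def)
  moreover have "emeasure lborel U \<le> emeasure lborel G"
    by (intro emeasure_mono) (auto simp: U_def G_def det_nonzero_regular)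
  ultimately show "emeasure lborel G \<noteq> 0" by auto
qed

lemma prob_space_frame_measure: "prob_space frame_measure"
  unfolding frame_measure_def by (rule prob_space_uniform_measure) (rule frame_set_emeasure)+

lemma AE_frame_measure: "AE M in frame_measure. M \<in> gs_regular"
  unfolding frame_measure_def by (rule AE_uniform_measureI) (use frame_set_emeasure(3) in auto)

text \<open>Acting by \<open>q\<close> on each row is a linear isometry \<open>F\<close> of the
  space of matrices, so it preserves volume. It also preserves the set \<open>G\<close>, because the
  frame of \<open>F M\<close> is the image under \<open>q\<close> of the frame of
  \<open>M\<close>.\<close>

lemma frame_measure_invariant:
  fixes q :: "real^'n \<Rightarrow> real^'n"
  assumes q: "orthogonal_transformation q"
  shows "distr frame_measure borel (\<lambda>M. \<chi> i. q (M $ i)) = frame_measure"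
proof -
  define F where "F = (\<lambda>M::real^'n^'n. \<chi> i. q (M $ i))"
  define G :: "(real^'n^'n) set" where "G = gs_regular \<inter> ball 0 (norm (mat 1 :: real^'n^'n) + 1)"
  have nq: "norm (q x) = norm x" and linq: "linear q" for x
    using q by (auto simp: orthogonal_transformation)
  have linF: "linear F"
    by (rule linearI) (auto simp: F_def vec_eq_iff linear_add[OF linq] linear_cmul[OF linq])
  have nF: "norm (F M) = norm M" for M
    unfolding norm_vec_def[of "F M"] norm_vec_def[of M] by (simp add: F_def nq)
  have [measurable]: "F \<in> borel_measurable borel"
    using linF by (intro borel_measurable_continuous_onI linear_continuous_on) (simp add: linear_conv_bounded_linear)
  have [measurable]: "G \<in> sets borel" unfolding G_def by (rule frame_set_emeasure)
  have G: "F M \<in> G \<longleftrightarrow> M \<in> G" for M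
    unfolding G_def gs_regular_def by (simp add: nF) (simp add: F_def gs_row_equivariant[OF q] nq)
  have "distr frame_measure borel F = frame_measure"
  proof (rule measure_eqI)
    fix A assume "A \<in> sets (distr frame_measure borel F)"
    then have [measurable]: "A \<in> sets borel" by simp
    have FA: "F -` A \<in> sets borel" using measurable_sets[of F borel borel A] by simp
    have "emeasure (distr frame_measure borel F) A = emeasure frame_measure (F -` A)"
      by (subst emeasure_distr) auto
    also have "\<dots> = emeasure lborel (G \<inter> F -` A) / emeasure lborel G"
      unfolding frame_measure_def G_def[symmetric] using FA by simp
    also have "G \<inter> F -` A = F -` (G \<inter> A)" using G by auto
    also have "emeasure lborel (F -` (G \<inter> A)) = emeasure lborel (G \<inter> A)"
      by (rule emeasure_lborel_isometry_vimage[OF linF nF]) measurable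
    also have "emeasure lborel (G \<inter> A) / emeasure lborel G = emeasure frame_measure A"
      unfolding frame_measure_def G_def[symmetric] by simp
    finally show "emeasure (distr frame_measure borel F) A = emeasure frame_measure A" .
  qed (simp add: sets_frame_measure)
  then show ?thesis unfolding F_def .
qed

lemma gs_apply_measurable [measurable (raw)]:
  fixes g :: "'b \<Rightarrow> real^'n"
  assumes [measurable]: "f \<in> borel_measurable M" "g \<in> borel_measurable M"
  shows "(\<lambda>x. gs_apply (f x) (g x)) \<in> borel_measurable M"
proof -
  have "(\<lambda>x. gs_apply (f x) (g x) \<bullet> b) \<in> borel_measurable M" if "b \<in> Basis" for b :: "real^'n"
  proof -
    obtain i where "b = axis i 1" using \<open>b \<in> Basis\<close> by (force simp: Basis_vec_def)
    then have "(\<lambda>x. gs_apply (f x) (g x) \<bullet> b) = (\<lambda>x. gs_row (f x) i \<bullet> g x)"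
      by (simp add: gs_apply_def inner_axis)
    moreover have "(\<lambda>x. gs_row (f x) i) \<in> borel_measurable M"
      by (rule measurable_compose[OF assms(1) borel_measurable_gs_row])
    ultimately show ?thesis by simp
  qed
  then show ?thesis by (subst borel_measurable_euclidean_space) blast
qed

lemma gs_apply_equivariant:
  assumes q: "orthogonal_transformation q"
  shows "gs_apply (\<chi> i. q (M $ i)) (q x) = gs_apply M x"
  using q by (simp add: gs_apply_def gs_row_equivariant orthogonal_transformation_def)

text \<open>Rotating the rows and the vector together changes no coordinate, so a rotation taking
  \<open>x\<close> to \<open>y\<close> is absorbed into the invariant distribution of
  \<open>M\<close>. Transitivity on spheres supplies the rotation.\<close>

lemma integral_frame_radial:
  fixes h :: "real^'n \<Rightarrow> real"
  assumes [measurable]: "h \<in> borel_measurable borel" and "norm x = norm y"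
  shows "(\<integral>M. h (gs_apply M x) \<partial>frame_measure) = (\<integral>M. h (gs_apply M y) \<partial>frame_measure)"
proof -
  obtain q where q: "orthogonal_transformation q" and y: "q x = y"
    using orthogonal_transformation_exists[OF assms(2)] by blast
  have linq: "linear q" using q by (simp add: orthogonal_transformation_def)
  have "linear (\<lambda>M::real^'n^'n. \<chi> i. q (M $ i))"
    by (rule linearI) (auto simp: vec_eq_iff linear_add[OF linq] linear_cmul[OF linq])
  then have [measurable]: "(\<lambda>M::real^'n^'n. \<chi> i. q (M $ i)) \<in> borel_measurable borel"
    by (intro borel_measurable_continuous_onI linear_continuous_on) (simp add: linear_conv_bounded_linear)
  have "(\<integral>M. h (gs_apply M y) \<partial>frame_measure)
     = (\<integral>M. h (gs_apply M y) \<partial>distr frame_measure borel (\<lambda>M. \<chi> i. q (M $ i)))"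
    by (simp only: frame_measure_invariant[OF q])
  also have "\<dots> = (\<integral>M. h (gs_apply (\<chi> i. q (M $ i)) y) \<partial>frame_measure)"
    by (rule integral_distr) measurable
  finally show ?thesis
    by (simp add: gs_apply_equivariant[OF q] flip: y)
qed

section \<open>Autocorrelation of periodic sets\<close>

locale periodic_set =
  fixes L :: real and P :: "(real^'n) set"
  assumes L: "L > 0" and closed: "closed P"
    and periodic: "\<And>x v. v \<in> lattice L \<Longrightarrow> x + v \<in> P \<longleftrightarrow> x \<in> P"
begin

sublocale torus: prob_space "torus L :: (real^'n) measure"
  by (rule prob_space_torus[OF L])

lemma P_borel [measurable]: "P \<in> sets borel"
  using closed by (rule borel_closed)

abbreviation ind :: "real^'n \<Rightarrow> real" where "ind \<equiv> indicator P"

lemma ind_periodic: "v \<in> lattice L \<Longrightarrow> ind (x + v) = ind x"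
  by (simp add: indicator_def periodic)

lemma ind_periodic': "v \<in> lattice L \<Longrightarrow> ind (x + v + y) = ind (x + y)"
  using ind_periodic[of v "x + y"] by (simp add: ac_simps)

lemma ind_measurable [measurable (raw)]:
  "g \<in> borel_measurable M \<Longrightarrow> (\<lambda>x. ind (g x)) \<in> borel_measurable M"
  by (rule measurable_compose[of g M borel]) (auto intro: borel_measurable_indicator P_borel)

definition p :: real where "p = measure (torus L) P"

definition corr :: "real^'n \<Rightarrow> real" where
  "corr x = (\<integral>z. ind z * ind (z + x) \<partial>torus L)"

lemma integrable_torus_bounded:
  fixes g :: "real^'n \<Rightarrow> real"
  assumes "g \<in> borel_measurable borel" "\<And>x. \<bar>g x\<bar> \<le> B"
  shows "integrable (torus L) g"
proof (rule torus.integrable_const_bound[of _ B])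
  show "g \<in> borel_measurable (torus L)"
    using assms(1) by (simp cong: measurable_cong_sets add: sets_torus)
qed (simp add: assms(2))

lemma ind_bound: "0 \<le> ind x" "ind x \<le> 1"
  by (auto simp: indicator_def)

lemma integral_ind: "(\<integral>z. ind z \<partial>torus L) = p"
  unfolding p_def by simp

lemma integral_ind_shift: "(\<integral>z. ind (z + x) \<partial>torus L) = p"
  unfolding integral_ind[symmetric]
  by (rule integral_torus_shift[OF L, of ind x]) (auto simp: ind_bound ind_periodic intro: borel_measurable_indicator P_borel)

lemma corr_0: "corr 0 = p"
proof -
  have "corr 0 = (\<integral>z. ind z \<partial>torus L)"
    unfolding corr_def by (intro Bochner_Integration.integral_cong) (auto simp: indicator_def)
  then show ?thesis by (simp only: integral_ind)
qed

text \<open>Shifting the integration variable by \<open>y\<close> makes the formula symmetric in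
  \<open>x\<close> and \<open>y\<close>; the symmetry and the positive type of the autocorrelation
  both come from this form.\<close>

lemma corr_diff: "corr (x - y) = (\<integral>z. ind (z + x) * ind (z + y) \<partial>torus L)"
proof -
  have "(\<integral>z. ind (z + y) * ind (z + y + (x - y)) \<partial>torus L) = corr (x - y)"
    unfolding corr_def
    by (rule integral_torus_shift[OF L, of "\<lambda>z. ind z * ind (z + (x - y))"])
      (simp_all add: ind_bound ind_periodic ind_periodic')
  then show ?thesis by (simp add: mult.commute)
qed

lemma corr_nonneg: "0 \<le> corr x"
  unfolding corr_def by (intro integral_nonneg_AE) (simp add: ind_bound)

lemma corr_le: "corr x \<le> p"
proof -
  have "corr x \<le> (\<integral>z. ind z \<partial>torus L)"
    unfolding corr_def
    by (intro integral_mono integrable_torus_bounded[of _ 1]) (auto simp: indicator_def)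
  then show ?thesis by (simp only: integral_ind)
qed

lemma p_le_1: "p \<le> 1"
  unfolding p_def by (rule torus.prob_le_1)

text \<open>The quadratic form becomes the integral of a square, hence nonnegative. The points enter
  through a map \<open>a\<close> that need not be injective, so the identity applies with
  \<open>gs_apply M\<close> for every matrix, singular ones included.\<close>

lemma sum_corr:
  shows "(\<Sum>x\<in>U. \<Sum>y\<in>U. c x * c y * corr (a x - a y)) = (\<integral>z. (\<Sum>x\<in>U. c x * ind (z + a x))\<^sup>2 \<partial>torus L)"
proof -
  have "(\<Sum>x\<in>U. \<Sum>y\<in>U. c x * c y * corr (a x - a y))
      = (\<Sum>x\<in>U. \<Sum>y\<in>U. (\<integral>z. c x * c y * (ind (z + a x) * ind (z + a y)) \<partial>torus L))"
    unfolding corr_diff by simp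
  also have "\<dots> = (\<integral>z. (\<Sum>x\<in>U. \<Sum>y\<in>U. c x * c y * (ind (z + a x) * ind (z + a y))) \<partial>torus L)"
  proof -
    have int: "integrable (torus L) (\<lambda>z. c x * c y * (ind (z + a x) * ind (z + a y)))" for x y
      by (intro integrable_mult_right integrable_torus_bounded[of _ 1]) (auto simp: indicator_def)
    show ?thesis
      by (simp only: Bochner_Integration.integral_sum[OF Bochner_Integration.integrable_sum[OF int]]
          Bochner_Integration.integral_sum[OF int])
  qed
  also have "\<dots> = (\<integral>z. (\<Sum>x\<in>U. c x * ind (z + a x))\<^sup>2 \<partial>torus L)"
    by (simp add: power2_eq_square sum_product mult_ac)
  finally show ?thesis .
qed

text \<open>The two integrands can differ only where exactly one of \<open>z + x + h\<close> and
  \<open>z + x\<close> lies in \<open>P\<close>, a set of measure \<open>2 * (p - corr h)\<close>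
  whatever \<open>x\<close> is. Continuity is thereby reduced to continuity at 0.\<close>

lemma corr_diff_le: "\<bar>corr (x + h) - corr x\<bar> \<le> 2 * (p - corr h)"
proof -
  have "corr (x + h) - corr x = (\<integral>z. ind z * ind (z + (x + h)) - ind z * ind (z + x) \<partial>torus L)"
    unfolding corr_def
    by (intro Bochner_Integration.integral_diff[symmetric] integrable_torus_bounded[of _ 1]) (auto simp: indicator_def)
  also have "\<bar>\<dots>\<bar> \<le> (\<integral>z. \<bar>ind z * ind (z + (x + h)) - ind z * ind (z + x)\<bar> \<partial>torus L)"
    by (rule integral_abs_bound)
  \<comment> \<open>For values a, b in {0, 1}, |a - b| = a + b - 2ab; the common factor
    \<open>ind z\<close> is at most 1.\<close>
  also have "\<dots> \<le> (\<integral>z. ind (z + x + h) + ind (z + x) - 2 * (ind (z + (x + h)) * ind (z + x)) \<partial>torus L)"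
    by (intro integral_mono integrable_torus_bounded[of _ 4]) (auto simp: indicator_def add.assoc)
  also have "\<dots> = (\<integral>z. ind (z + x + h) \<partial>torus L) + (\<integral>z. ind (z + x) \<partial>torus L)
      - 2 * (\<integral>z. ind (z + (x + h)) * ind (z + x) \<partial>torus L)"
  proof -
    have "integrable (torus L) (\<lambda>z. ind (z + x + h))" "integrable (torus L) (\<lambda>z. ind (z + x))"
       "integrable (torus L) (\<lambda>z. ind (z + (x + h)) * ind (z + x))"
      by (intro integrable_torus_bounded[of _ 1]; force simp: indicator_def)+
    then show ?thesis by simp
  qed
  also have "\<dots> = 2 * (p - corr h)"
    using corr_diff[of "x + h" x] by (simp add: integral_ind_shift add.assoc)
  finally show ?thesis .
qed

text \<open>Closedness of \<open>P\<close> enters here: a point outside \<open>P\<close> stays outside under small shifts.\<close>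

lemma corr_tendsto_0: "h \<longlonglongrightarrow> 0 \<Longrightarrow> (\<lambda>j. corr (h j)) \<longlonglongrightarrow> p"
proof -
  assume h: "h \<longlonglongrightarrow> 0"
  \<comment> \<open>A one-sided difference suffices: a shift of \<open>P\<close> has the same
    measure as \<open>P\<close>, so the part of it outside \<open>P\<close> has measure exactly
    \<open>p - corr (h j)\<close>.\<close>
  have "(\<lambda>j. \<integral>z. ind (z + h j) * (1 - ind z) \<partial>torus L) \<longlonglongrightarrow> (\<integral>z. 0 \<partial>(torus L :: (real^'n) measure))"
  proof (rule integral_dominated_convergence[where w = "\<lambda>_. 1"])
    show "AE z in torus L. (\<lambda>j. ind (z + h j) * (1 - ind z)) \<longlonglongrightarrow> 0"
    proof (rule AE_I2)
      fix z
      show "(\<lambda>j. ind (z + h j) * (1 - ind z)) \<longlonglongrightarrow> 0"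
      proof (cases "z \<in> P")
        case False
        have "(\<lambda>j. z + h j) \<longlonglongrightarrow> z + 0" by (intro tendsto_intros h)
        then have "eventually (\<lambda>j. z + h j \<in> - P) sequentially"
          by (rule topological_tendstoD) (use closed False in auto)
        then show ?thesis
          by (intro tendsto_eventually) (auto elim!: eventually_mono)
      qed simp
    qed
  qed (auto simp: indicator_def)
  moreover have "(\<integral>z. ind (z + h j) * (1 - ind z) \<partial>torus L) = p - corr (h j)" for j
  proof -
    have "integrable (torus L) (\<lambda>z. ind (z + h j))" "integrable (torus L) (\<lambda>z. ind z * ind (z + h j))"
      by (intro integrable_torus_bounded[of _ 1]; force simp: indicator_def)+
    then have "p - corr (h j) = (\<integral>z. ind (z + h j) - ind z * ind (z + h j) \<partial>torus L)"
      unfolding corr_def integral_ind_shift[of "h j", symmetric] by simp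
    then show ?thesis by (simp add: algebra_simps)
  qed
  ultimately have "(\<lambda>j. p - corr (h j)) \<longlonglongrightarrow> 0" by simp
  from tendsto_diff[OF tendsto_const[of p] this] show ?thesis by simp
qed

lemma continuous_corr: "continuous_on UNIV corr"
  unfolding continuous_on_sequentially
proof (intro ballI allI impI, elim conjE)
  fix x :: "nat \<Rightarrow> real^'n" and a assume x: "x \<longlonglongrightarrow> a"
  have "(\<lambda>j. corr (x j - a)) \<longlonglongrightarrow> p"
    by (rule corr_tendsto_0) (use x in \<open>simp add: LIM_zero\<close>)
  then have "(\<lambda>j. 2 * (p - corr (x j - a))) \<longlonglongrightarrow> 2 * (p - p)"
    by (intro tendsto_intros)
  then have "(\<lambda>j. 2 * (p - corr (x j - a))) \<longlonglongrightarrow> 0" by simp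
  then have "(\<lambda>j. corr (x j) - corr a) \<longlonglongrightarrow> 0"
    by (rule Lim_null_comparison[rotated])
      (use corr_diff_le[of a "x j - a" for j] in \<open>auto intro!: always_eventually\<close>)
  then show "(corr \<circ> x) \<longlonglongrightarrow> corr a"
    by (simp add: LIM_zero_iff o_def)
qed

lemma corr_borel [measurable]: "corr \<in> borel_measurable borel"
  by (rule borel_measurable_continuous_onI[OF continuous_corr])

text \<open>For fixed \<open>z\<close>, the average over \<open>y\<close> covers a full period and
  equals \<open>p\<close> wherever it starts. This is the source of the mean
  \<open>p\<^sup>2\<close>.\<close>

lemma integral_corr: "(\<integral>y. corr (x + y) \<partial>torus L) = p\<^sup>2"
proof -
  interpret TT: pair_prob_space "torus L :: (real^'n) measure" "torus L :: (real^'n) measure" ..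
  have "(\<integral>y. corr (x + y) \<partial>torus L) = (\<integral>y. (\<integral>z. ind z * ind (z + (x + y)) \<partial>torus L) \<partial>torus L)"
    unfolding corr_def ..
  also have "\<dots> = (\<integral>z. (\<integral>y. ind z * ind (z + (x + y)) \<partial>torus L) \<partial>torus L)"
    by (rule TT.Fubini_integral, rule TT.integrable_const_bound[of _ 1]) (auto simp: indicator_def)
  also have "\<dots> = (\<integral>z. ind z * p \<partial>torus L)"
    using integral_ind_shift[of "x + z" for z] by (simp add: ac_simps)
  also have "\<dots> = p\<^sup>2" by (simp add: p_def power2_eq_square)
  finally show ?thesis .
qed

end

section \<open>Averaging over cubes and isometries\<close>

lemma integral_uniform_measure:
  fixes f :: "'a \<Rightarrow> real"
  assumes [measurable]: "A \<in> sets M" "f \<in> borel_measurable M"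
    and fin: "emeasure M A \<noteq> 0" "emeasure M A \<noteq> \<infinity>"
  shows "(\<integral>x. f x \<partial>uniform_measure M A) = (\<integral>x. indicator A x * f x \<partial>M) / measure M A"
proof -
  have e: "emeasure M A = ennreal (measure M A)"
    using fin(2) by (simp add: emeasure_eq_ennreal_measure)
  then have pos: "measure M A > 0"
    using fin(1) by (cases "measure M A = 0") (simp_all add: less_le)
  have "indicator A x / ennreal (measure M A) = ennreal (indicator A x / measure M A)" for x
    using divide_ennreal[of 1 "measure M A"] pos by (cases "x \<in> A") simp_all
  then have "uniform_measure M A = density M (\<lambda>x. ennreal (indicator A x / measure M A))"
    unfolding uniform_measure_def e by simp
  then have "(\<integral>x. f x \<partial>uniform_measure M A) = (\<integral>x. (indicator A x / measure M A) *\<^sub>R f x \<partial>M)"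
    by (simp only:) (rule integral_density; simp)
  then show ?thesis by simp
qed

lemma (in prob_space) abs_integral_diff_const_le:
  fixes f :: "'a \<Rightarrow> real"
  assumes "integrable M f" "AE x in M. \<bar>f x - c\<bar> \<le> b"
  shows "\<bar>(\<integral>x. f x \<partial>M) - c\<bar> \<le> b"
proof -
  have "(\<integral>x. f x \<partial>M) \<le> c + b"
    by (rule integral_le_const[OF assms(1)]) (use assms(2) in \<open>auto elim!: eventually_mono\<close>)
  moreover have "(\<integral>x. f x \<partial>M) \<ge> c - b"
    by (rule integral_ge_const[OF assms(1)]) (use assms(2) in \<open>auto elim!: eventually_mono\<close>)
  ultimately show ?thesis by auto
qed

section \<open>Means over large cubes and their stability under translation\<close>

lemma cube_borel [measurable]: "(cube T :: (real^'n) set) \<in> sets borel"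
  by (simp add: cube_def)

lemma emeasure_cube: "T \<ge> 0 \<Longrightarrow> emeasure lborel (cube T :: (real^'n) set) = ennreal ((2 * T) ^ CARD('n))"
  using emeasure_bounded_finite[of "cube T :: (real^'n) set"] measure_cube[of T, where 'n='n]
  by (simp add: emeasure_eq_ennreal_measure cube_def)

definition cube_measure :: "real \<Rightarrow> (real^'n) measure" where
  "cube_measure T = uniform_measure lborel (cube T)"

lemma sets_cube_measure [measurable_cong]: "sets (cube_measure T) = sets borel"
  by (simp add: cube_measure_def)

lemma space_cube_measure [simp]: "space (cube_measure T) = UNIV"
  by (simp add: cube_measure_def)

lemma prob_space_cube_measure: "T > 0 \<Longrightarrow> prob_space (cube_measure T :: (real^'n) measure)"
  unfolding cube_measure_def by (rule prob_space_uniform_measure) (simp_all add: emeasure_cube)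

lemma integral_cube_measure:
  fixes f :: "real^'n \<Rightarrow> real"
  assumes "T > 0" "f \<in> borel_measurable borel"
  shows "(\<integral>x. f x \<partial>cube_measure T) = (\<integral>x. indicator (cube T) x * f x \<partial>lborel) / (2 * T) ^ CARD('n)"
  unfolding cube_measure_def
  using assms by (subst integral_uniform_measure) (simp_all add: emeasure_cube measure_cube)

lemma lborel_integral_shift:
  fixes f :: "'a::euclidean_space \<Rightarrow> real"
  assumes [measurable]: "f \<in> borel_measurable borel"
  shows "(\<integral>x. f (x + t) \<partial>lborel) = (\<integral>x. f x \<partial>lborel)"
  by (subst (2) lborel_distr_plus[of t, symmetric]) (simp add: integral_distr add.commute)

lemma integrable_cube_bounded:
  fixes g :: "real^'n \<Rightarrow> real"
  assumes [measurable]: "g \<in> borel_measurable borel" and "\<And>x. \<bar>g x\<bar> \<le> 1"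
  shows "integrable lborel (\<lambda>x. indicator (cube T) x * g x)"
proof (rule Bochner_Integration.integrable_bound[of _ "\<lambda>x :: real^'n. indicator (cube T) x :: real"])
  show "integrable lborel (\<lambda>x :: real^'n. indicator (cube T) x :: real)"
    using emeasure_bounded_finite[of "cube T :: (real^'n) set"]
    by (intro integrable_real_indicator) (auto simp: cube_def)
  show "AE x in lborel. norm (indicator (cube T) x * g x) \<le> norm (indicator (cube T) x :: real)"
    using assms(2) by (intro AE_I2) (auto simp: indicator_def)
qed measurable

text \<open>After the shift is moved from \<open>g\<close> to the cube, the first integral exceeds
  the second by at most the volume of the shell between the cubes of half-widths \<open>T\<close>
  and \<open>T + D\<close>, because \<open>0 \<le> g \<le> 1\<close>.\<close>

lemma cube_integral_shift_le:
  fixes g :: "real^'n \<Rightarrow> real"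
  assumes T: "T > 0" and [measurable]: "g \<in> borel_measurable borel"
    and g: "\<And>x. 0 \<le> g x" "\<And>x. g x \<le> 1" and v: "norm v \<le> D"
  shows "(\<integral>x. indicator (cube T) x * g (x + v) \<partial>lborel)
    \<le> (\<integral>x. indicator (cube T) x * g x \<partial>lborel) + ((2 * (T + D)) ^ CARD('n) - (2 * T) ^ CARD('n))"
proof -
  have D: "D \<ge> 0" using v norm_ge_zero order_trans by blast
  have sub: "x \<in> cube (T + D)" if "x - v \<in> cube T" for x
    unfolding cube_nth
  proof
    fix i
    have "\<bar>(x - v) $ i\<bar> \<le> T" "\<bar>v $ i\<bar> \<le> D"
      using that component_le_norm_cart[of v i] v by (auto simp: cube_nth simp del: vector_minus_component)
    then show "\<bar>x $ i\<bar> \<le> T + D" by auto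
  qed
  have gb: "\<bar>g x\<bar> \<le> 1" for x using g[of x] by simp
  have sub2: "x \<in> cube (T + D)" if "x \<in> cube T" for x :: "real^'n"
    using that D by (auto simp: cube_nth) (meson add_increasing2 order_trans)
  have "(\<integral>x. indicator (cube T) x * g (x + v) \<partial>lborel) = (\<integral>x. indicator (cube T) (x + v - v) * g (x + v) \<partial>lborel)"
    by simp
  also have "\<dots> = (\<integral>x. indicator (cube T) (x - v) * g x \<partial>lborel)"
    by (rule lborel_integral_shift[of "\<lambda>x. indicator (cube T) (x - v) * g x"]) measurable
  also have "\<dots> \<le> (\<integral>x. indicator (cube T) x * g x + (indicator (cube (T + D)) x * 1 - indicator (cube T) x * 1) \<partial>lborel)"
  proof (rule integral_mono_AE')
    show "integrable lborel (\<lambda>x. indicator (cube T) x * g x + (indicator (cube (T + D)) x * 1 - indicator (cube T) x * 1))"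
      by (intro Bochner_Integration.integrable_add Bochner_Integration.integrable_diff integrable_cube_bounded) (auto simp: gb)
    show "AE x in lborel. indicator (cube T) (x - v) * g x \<le>
        indicator (cube T) x * g x + (indicator (cube (T + D)) x * 1 - indicator (cube T) x * 1)"
      using g sub sub2 by (intro AE_I2) (auto simp: indicator_def)
    show "AE x in lborel. 0 \<le>
        indicator (cube T) x * g x + (indicator (cube (T + D)) x * 1 - indicator (cube T) x * 1)"
      using g sub2 by (intro AE_I2) (auto simp: indicator_def)
  qed
  also have "\<dots> = (\<integral>x. indicator (cube T) x * g x \<partial>lborel)
      + ((\<integral>x. indicator (cube (T + D) :: (real^'n) set) x * 1 \<partial>lborel) - (\<integral>x. indicator (cube T :: (real^'n) set) x * 1 \<partial>lborel))"
    proof -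
    have i: "integrable lborel (\<lambda>x. indicator (cube T) x * g x)" "integrable lborel (\<lambda>x::real^'n. indicator (cube (T + D)) x * 1 :: real)"
      "integrable lborel (\<lambda>x::real^'n. indicator (cube T) x * 1 :: real)"
      by (rule integrable_cube_bounded; simp add: gb)+
    show ?thesis
      by (simp only: Bochner_Integration.integral_add[OF i(1) Bochner_Integration.integrable_diff[OF i(2,3)]]
        Bochner_Integration.integral_diff[OF i(2,3)])
  qed
  also have "\<dots> = (\<integral>x. indicator (cube T) x * g x \<partial>lborel) + ((2 * (T + D)) ^ CARD('n) - (2 * T) ^ CARD('n))"
    using T D by (simp add: measure_cube)
  finally show ?thesis .
qed

lemma cube_measure_shift:
  fixes g :: "real^'n \<Rightarrow> real"
  assumes T: "T > 0" and [measurable]: "g \<in> borel_measurable borel"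
    and g: "\<And>x. 0 \<le> g x" "\<And>x. g x \<le> 1" and v: "norm v \<le> D"
  shows "\<bar>(\<integral>x. g (x + v) \<partial>cube_measure T) - (\<integral>x. g x \<partial>cube_measure T)\<bar> \<le> ((T + D) / T) ^ CARD('n) - 1"
proof -
  let ?I = "\<lambda>g. (\<integral>x. indicator (cube T) x * g x \<partial>lborel) :: real" and ?d = "(2 * (T + D)) ^ CARD('n) - (2 * T) ^ CARD('n)"
  have "?I (\<lambda>x. g (x + v)) \<le> ?I g + ?d"
    by (rule cube_integral_shift_le[OF T _ g v]) measurable
  \<comment> \<open>The same estimate for the translate of \<open>g\<close>, with the opposite
    vector, gives the reverse inequality.\<close>
  moreover have "?I (\<lambda>x. g (x + - v + v)) \<le> ?I (\<lambda>x. g (x + v)) + ?d"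
    using cube_integral_shift_le[OF T, of "\<lambda>x. g (x + v)" "- v" D] g v by simp
  ultimately have "\<bar>?I (\<lambda>x. g (x + v)) - ?I g\<bar> \<le> ?d" by simp
  then have "\<bar>?I (\<lambda>x. g (x + v)) - ?I g\<bar> / (2 * T) ^ CARD('n) \<le> ?d / (2 * T) ^ CARD('n)"
    using T by (intro divide_right_mono) auto
  moreover have "?d / (2 * T) ^ CARD('n) = ((T + D) / T) ^ CARD('n) - 1"
  proof -
    have "(2 * (T + D)) / (2 * T) = (T + D) / T" by (rule mult_divide_mult_cancel_left) simp
    then show ?thesis using T by (simp only: diff_divide_distrib power_divide[symmetric]) simp
  qed
  moreover have "\<bar>?I (\<lambda>x. g (x + v)) - ?I g\<bar> / (2 * T) ^ CARD('n)
      = \<bar>(\<integral>x. g (x + v) \<partial>cube_measure T) - (\<integral>x. g x \<partial>cube_measure T)\<bar>"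
    using T by (simp add: integral_cube_measure diff_divide_distrib[symmetric])
  ultimately show ?thesis by simp
qed

text \<open>\<open>mean_value\<close> is written with \<open>Lim\<close>, which says something only
  when the limit exists. Convergence of the Borel cube averages supplies both existence and
  value.\<close>

lemma mean_valueI:
  fixes f :: "real^'n \<Rightarrow> real"
  assumes [measurable]: "f \<in> borel_measurable borel"
    and lim: "((\<lambda>T. \<integral>x. f x \<partial>cube_measure T) \<longlongrightarrow> m) at_top"
  shows "mean_value f = m"
proof -
  have "((\<lambda>T. (LINT x:cube T|lebesgue. f x) / measure lebesgue (cube T :: (real^'n) set)) \<longlongrightarrow> m) at_top"
  proof (rule Lim_transform_eventually[OF lim])
    show "\<forall>\<^sub>F T in at_top. (\<integral>x. f x \<partial>cube_measure T) =
        (LINT x:cube T|lebesgue. f x) / measure lebesgue (cube T :: (real^'n) set)"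
      using eventually_gt_at_top[of 0]
    proof eventually_elim
      case (elim T)
      have "(LINT x:cube T|lebesgue. f x) = (\<integral>x. indicator (cube T) x * f x \<partial>lborel)"
        unfolding set_lebesgue_integral_def by (subst integral_completion) simp_all
      moreover have "measure lebesgue (cube T :: (real^'n) set) = (2 * T) ^ CARD('n)"
        using elim measure_cube[of T, where 'n='n] by (simp add: measure_completion)
      ultimately show ?case using elim by (simp add: integral_cube_measure)
    qed
  qed
  then show ?thesis
    unfolding mean_value_def by (intro tendsto_Lim) auto
qed

lemma gs_apply_linear: "linear (gs_apply M)"
  by (rule linearI) (auto simp: gs_apply_def vec_eq_iff inner_add_right)

lemma norm_cell_bound:
  fixes y :: "real^'n"
  assumes "y \<in> cell L" shows "norm y \<le> L / 2 * CARD('n)"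
proof -
  have "norm y \<le> (\<Sum>i\<in>UNIV. \<bar>y $ i\<bar>)" by (rule norm_le_l1_cart)
  also have "\<dots> \<le> (\<Sum>i\<in>(UNIV::'n set). L / 2)"
  proof (rule sum_mono)
    fix i
    have "- L / 2 \<le> y $ i" "y $ i < L / 2" using assms by (auto simp: cell_def)
    then show "\<bar>y $ i\<bar> \<le> L / 2" by linarith
  qed
  finally show ?thesis by (simp add: mult.commute)
qed

section \<open>The isometry average of the autocorrelation and its mean\<close>

context periodic_set
begin

sublocale frame: prob_space "frame_measure :: (real^'n^'n) measure"
  by (rule prob_space_frame_measure)

definition rcorr :: "real^'n \<Rightarrow> real" where
  "rcorr x = (\<integral>M. corr (gs_apply M x) \<partial>frame_measure)"

lemma corr_bounds: "0 \<le> corr x" "corr x \<le> 1" "\<bar>corr x\<bar> \<le> 1"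
  using corr_nonneg[of x] corr_le[of x] p_le_1 by auto

lemma integrable_corr_gs: "integrable frame_measure (\<lambda>M. corr (gs_apply M x))"
  by (rule frame.integrable_const_bound[of _ 1]) (auto simp: corr_bounds)

lemma rcorr_0: "rcorr 0 = p"
proof -
  have "gs_apply M 0 = (0 :: real^'n)" for M by (simp add: gs_apply_def vec_eq_iff)
  then show ?thesis using frame.prob_space by (simp add: rcorr_def corr_0)
qed

lemma radial_rcorr: "radial rcorr"
  unfolding radial_def rcorr_def by (auto intro: integral_frame_radial)

lemma positive_type_rcorr: "positive_type rcorr"
  unfolding positive_type_def
proof (intro allI impI conjI ballI)
  fix x y :: "real^'n"
  have "corr (gs_apply M (x - y)) = corr (gs_apply M (y - x))" for M
    using corr_diff[of "gs_apply M x" "gs_apply M y"] corr_diff[of "gs_apply M y" "gs_apply M x"]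
    by (simp add: linear_diff[OF gs_apply_linear] mult.commute)
  then show "rcorr (x - y) = rcorr (y - x)" by (simp add: rcorr_def)
next
  fix U :: "(real^'n) set" and c :: "real^'n \<Rightarrow> real"
  have "(\<Sum>x\<in>U. \<Sum>y\<in>U. c x * c y * rcorr (x - y))
      = (\<Sum>x\<in>U. \<Sum>y\<in>U. (\<integral>M. c x * c y * corr (gs_apply M (x - y)) \<partial>frame_measure))"
    unfolding rcorr_def by simp
  also have "\<dots> = (\<integral>M. (\<Sum>x\<in>U. \<Sum>y\<in>U. c x * c y * corr (gs_apply M (x - y))) \<partial>frame_measure)"
  proof -
    have int: "integrable frame_measure (\<lambda>M. c x * c y * corr (gs_apply M (x - y)))" for x y
      by (intro integrable_mult_right integrable_corr_gs)
    show ?thesis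
      by (simp only: Bochner_Integration.integral_sum[OF Bochner_Integration.integrable_sum[OF int]]
          Bochner_Integration.integral_sum[OF int])
  qed
  also have "\<dots> \<ge> 0"
  proof (intro integral_nonneg_AE AE_I2)
    fix M :: "real^'n^'n"
    define z where "z w = (\<Sum>x\<in>U. c x * ind (w + gs_apply M x))" for w
    have "(\<Sum>x\<in>U. \<Sum>y\<in>U. c x * c y * corr (gs_apply M (x - y))) = (\<integral>w. (z w)\<^sup>2 \<partial>torus L)"
      unfolding z_def linear_diff[OF gs_apply_linear] by (rule sum_corr)
    then show "0 \<le> (\<Sum>x\<in>U. \<Sum>y\<in>U. c x * c y * corr (gs_apply M (x - y)))"
      by simp
  qed
  finally show "(\<Sum>x\<in>U. \<Sum>y\<in>U. c x * c y * rcorr (x - y)) \<ge> 0" .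
qed

lemma continuous_gs_apply: "continuous_on S (gs_apply M :: real^'n \<Rightarrow> real^'n)"
  using gs_apply_linear by (intro linear_continuous_on) (simp add: linear_conv_bounded_linear)

lemma continuous_rcorr: "continuous_on UNIV rcorr"
  unfolding continuous_on_sequentially
proof (intro ballI allI impI, elim conjE)
  fix x :: "nat \<Rightarrow> real^'n" and a assume x: "x \<longlonglongrightarrow> a"
  have "(\<lambda>j. rcorr (x j)) \<longlonglongrightarrow> rcorr a"
    unfolding rcorr_def
  proof (rule integral_dominated_convergence[where w = "\<lambda>_. 1"])
    show "AE M in frame_measure. (\<lambda>j. corr (gs_apply M (x j))) \<longlonglongrightarrow> corr (gs_apply M a)"
    proof (rule AE_I2)
      fix M :: "real^'n^'n"
      have "continuous_on UNIV (\<lambda>x. corr (gs_apply M x))"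
        by (rule continuous_on_compose2[OF continuous_corr continuous_gs_apply]) auto
      then show "(\<lambda>j. corr (gs_apply M (x j))) \<longlonglongrightarrow> corr (gs_apply M a)"
        using x by (auto simp: continuous_on_sequentially o_def)
    qed
  qed (auto simp: corr_bounds)
  then show "(rcorr \<circ> x) \<longlonglongrightarrow> rcorr a" by (simp add: o_def)
qed

lemma rcorr_borel [measurable]: "rcorr \<in> borel_measurable borel"
  by (rule borel_measurable_continuous_onI[OF continuous_rcorr])

text \<open>Averaging \<open>corr (Y x + y)\<close> over \<open>y\<close> in one cell gives exactly
  \<open>p\<^sup>2\<close> at every \<open>x\<close>. Each shift by \<open>y\<close> is a bounded
  shift of \<open>x\<close> itself, since \<open>Y\<close> is a surjective isometry, and so changes
  the cube mean only by a boundary term. The error bound is the same for all \<open>Y\<close>, which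
  allows averaging over isometries.\<close>

lemma cube_mean_corr:
  fixes Y :: "real^'n \<Rightarrow> real^'n"
  assumes Y: "orthogonal_transformation Y" and T: "T > 0"
  shows "\<bar>(\<integral>x. corr (Y x) \<partial>cube_measure T) - p\<^sup>2\<bar> \<le> ((T + L / 2 * CARD('n)) / T) ^ CARD('n) - 1"
proof -
  interpret C: prob_space "cube_measure T :: (real^'n) measure" by (rule prob_space_cube_measure[OF T])
  interpret CT: pair_prob_space "cube_measure T :: (real^'n) measure" "torus L :: (real^'n) measure" ..
  have lin: "linear Y" using Y by (simp add: orthogonal_transformation_def)
  have [measurable]: "Y \<in> borel_measurable borel"
    using lin by (intro borel_measurable_continuous_onI linear_continuous_on) (simp add: linear_conv_bounded_linear)
  have "measure (cube_measure T :: (real^'n) measure) UNIV = 1"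
    using C.prob_space by (simp only: space_cube_measure)
  then have "p\<^sup>2 = (\<integral>x. p\<^sup>2 \<partial>(cube_measure T :: (real^'n) measure))" by simp
  also have "\<dots> = (\<integral>x. (\<integral>y. corr (Y x + y) \<partial>torus L) \<partial>cube_measure T)"
    by (simp add: integral_corr)
  also have "\<dots> = (\<integral>y. (\<integral>x. corr (Y x + y) \<partial>cube_measure T) \<partial>torus L)"
    by (rule CT.Fubini_integral[symmetric], rule CT.integrable_const_bound[of _ 1]) (auto simp: corr_bounds)
  finally have eq: "p\<^sup>2 = (\<integral>y. (\<integral>x. corr (Y x + y) \<partial>cube_measure T) \<partial>torus L)" .
  have "\<bar>(\<integral>y. (\<integral>x. corr (Y x + y) \<partial>cube_measure T) \<partial>torus L) - (\<integral>x. corr (Y x) \<partial>cube_measure T)\<bar>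
      \<le> ((T + L / 2 * CARD('n)) / T) ^ CARD('n) - 1"
  proof (rule torus.abs_integral_diff_const_le)
    show "integrable (torus L) (\<lambda>y. \<integral>x. corr (Y x + y) \<partial>cube_measure T)"
    proof (rule integrable_torus_bounded[of _ 1])
      show "\<bar>\<integral>x. corr (Y x + y) \<partial>cube_measure T\<bar> \<le> 1" for y
        using C.abs_integral_diff_const_le[OF C.integrable_const_bound[of "\<lambda>x. corr (Y x + y)" 1], of 0 1]
        by (simp add: corr_bounds)
    qed (rule C.borel_measurable_lebesgue_integral, measurable)
    have "AE y in torus L. y \<in> (cell L :: (real^'n) set)"
      unfolding torus_def by (rule AE_uniform_measureI) auto
    then show "AE y in torus L. \<bar>(\<integral>x. corr (Y x + y) \<partial>cube_measure T) - (\<integral>x. corr (Y x) \<partial>cube_measure T)\<bar>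
        \<le> ((T + L / 2 * CARD('n)) / T) ^ CARD('n) - 1"
    proof eventually_elim
      case (elim y)
      obtain v where v: "Y v = y"
        using orthogonal_transformation_surj[OF Y] by (metis surjD)
      have "norm v \<le> L / 2 * CARD('n)"
        using norm_cell_bound[OF elim] Y v by (auto simp: orthogonal_transformation)
      then show ?case
        using cube_measure_shift[OF T, of "\<lambda>x. corr (Y x)" v "L / 2 * CARD('n)"] by (simp add: linear_add[OF lin] v corr_bounds)
    qed
  qed
  then show ?thesis unfolding eq[symmetric] by (simp add: abs_minus_commute)
qed

text \<open>The bound for a single isometry is uniform and almost every matrix is regular, so the
  bound survives integration over matrices.\<close>

lemma cube_mean_rcorr:
  assumes T: "T > 0"
  shows "\<bar>(\<integral>x. rcorr x \<partial>cube_measure T) - p\<^sup>2\<bar> \<le> ((T + L / 2 * CARD('n)) / T) ^ CARD('n) - 1"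
proof -
  interpret C: prob_space "cube_measure T :: (real^'n) measure" by (rule prob_space_cube_measure[OF T])
  interpret CF: pair_prob_space "cube_measure T :: (real^'n) measure" "frame_measure :: (real^'n^'n) measure" ..
  have "(\<integral>x. rcorr x \<partial>cube_measure T) = (\<integral>M. (\<integral>x. corr (gs_apply M x) \<partial>cube_measure T) \<partial>frame_measure)"
    unfolding rcorr_def
    by (rule CF.Fubini_integral[symmetric], rule CF.integrable_const_bound[of _ 1]) (auto simp: corr_bounds)
  moreover have "\<bar>(\<integral>M. (\<integral>x. corr (gs_apply M x) \<partial>cube_measure T) \<partial>frame_measure) - p\<^sup>2\<bar> \<le> ((T + L / 2 * CARD('n)) / T) ^ CARD('n) - 1"
  proof (rule frame.abs_integral_diff_const_le)
    show "AE M in frame_measure. \<bar>(\<integral>x. corr (gs_apply M x) \<partial>cube_measure T) - p\<^sup>2\<bar> \<le> ((T + L / 2 * CARD('n)) / T) ^ CARD('n) - 1"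
      using AE_frame_measure by eventually_elim (rule cube_mean_corr[OF gs_apply_isometry T])
    show "integrable frame_measure (\<lambda>M. \<integral>x. corr (gs_apply M x) \<partial>cube_measure T)"
    proof (rule frame.integrable_const_bound[of _ 1])
      show "AE M in frame_measure. norm (\<integral>x. corr (gs_apply M x) \<partial>cube_measure T) \<le> 1"
      proof (rule AE_I2)
        fix M :: "real^'n^'n"
        show "norm (\<integral>x. corr (gs_apply M x) \<partial>cube_measure T) \<le> 1"
          using C.abs_integral_diff_const_le[OF C.integrable_const_bound[of "\<lambda>x. corr (gs_apply M x)" 1], of 0 1]
          by (simp add: corr_bounds)
      qed
    qed (rule C.borel_measurable_lebesgue_integral, measurable)
  qed
  ultimately show ?thesis by simp
qed

lemma mean_limit_rcorr: "((\<lambda>T. \<integral>x. rcorr x \<partial>cube_measure T) \<longlongrightarrow> p\<^sup>2) at_top"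
proof -
  have "((\<lambda>T::real. 1 + (L / 2 * CARD('n)) / T) \<longlongrightarrow> 1 + 0) at_top"
    by (intro tendsto_intros tendsto_divide_0[OF tendsto_const] filterlim_at_top_imp_at_infinity filterlim_ident)
  then have "((\<lambda>T::real. (1 + (L / 2 * CARD('n)) / T) ^ CARD('n) - 1) \<longlongrightarrow> (1 + 0) ^ CARD('n) - 1) at_top"
    by (intro tendsto_diff tendsto_power tendsto_const)
  then have "((\<lambda>T::real. (1 + (L / 2 * CARD('n)) / T) ^ CARD('n) - 1) \<longlongrightarrow> 0) at_top" by simp
  then have "((\<lambda>T. (\<integral>x. rcorr x \<partial>cube_measure T) - p\<^sup>2) \<longlongrightarrow> 0) at_top"
  proof (rule Lim_null_comparison[rotated])
    show "\<forall>\<^sub>F T in at_top. norm ((\<integral>x. rcorr x \<partial>cube_measure T) - p\<^sup>2) \<le> (1 + (L / 2 * CARD('n)) / T) ^ CARD('n) - 1"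
      using eventually_gt_at_top[of 0]
    proof eventually_elim
      case (elim T)
      then show ?case using cube_mean_rcorr[OF elim] by (simp add: add_divide_distrib)
    qed
  qed
  then show ?thesis by (simp add: LIM_zero_iff)
qed

end

section \<open>The value at distance one and the witness function\<close>

lemma alpha_sphere_upper:
  fixes I :: "(real^'n) set"
  assumes "I \<in> sets sphere_measure" "\<not> (\<exists>S\<subseteq>I. sphere_simplex k t S)"
  shows "measure sphere_measure I \<le> alpha_sphere TYPE('n) k t"
proof -
  interpret prob_space "sphere_measure :: (real^'n) measure" by (rule prob_space_sphere_measure)
  show ?thesis
    unfolding alpha_sphere_def
    by (rule cSUP_upper) (use assms in \<open>auto intro!: bdd_aboveI2[where M = 1] prob_le_1\<close>)
qed

text \<open>By the law of cosines, unit vectors with inner product 1/2 are at distance 1 from each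
  other, and each is at distance 1 from the origin. The apex \<open>y\<close> raises the count from
  \<open>k - 1\<close> to \<open>k\<close>, where \<open>k \<ge> 1\<close> controls the subtraction
  on naturals.\<close>

lemma avoids_unit_simplices_link:
  fixes P :: "(real^'n) set" and Y :: "real^'n \<Rightarrow> real^'n"
  assumes avoid: "avoids_unit_simplices k P" and k: "k \<ge> 1"
    and y: "y \<in> P" and Y: "orthogonal_transformation Y"
  shows "\<not> (\<exists>S\<subseteq>{\<xi>\<in>sphere 0 1. y + Y \<xi> \<in> P}. sphere_simplex (k - 1) (1 / 2) S)"
proof
  assume "\<exists>S\<subseteq>{\<xi>\<in>sphere 0 1. y + Y \<xi> \<in> P}. sphere_simplex (k - 1) (1 / 2) S"
  then obtain S where S: "S \<subseteq> {\<xi>\<in>sphere 0 1. y + Y \<xi> \<in> P}" "finite S" "card S = k - 1"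
    and ip: "\<And>a b. a \<in> S \<Longrightarrow> b \<in> S \<Longrightarrow> a \<noteq> b \<Longrightarrow> a \<bullet> b = 1 / 2"
    by (auto simp: sphere_simplex_def)
  have lin: "linear Y" and nrm: "norm (Y a) = norm a" for a
    using Y by (auto simp: orthogonal_transformation)
  have n1: "norm a = 1" if "a \<in> S" for a using S(1) that by auto
  have d: "dist (y + Y a) (y + Y b) = norm (a - b)" for a b
    by (simp add: dist_norm linear_diff[OF lin, symmetric] nrm)
  have dist1: "norm (a - b) = 1" if "a \<in> S" "b \<in> S" "a \<noteq> b" for a b
  proof -
    have "(norm (a - b))\<^sup>2 = (norm a)\<^sup>2 + (norm b)\<^sup>2 - 2 * (a \<bullet> b)"
      by (simp add: power2_norm_eq_inner inner_diff inner_commute)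
    then have "(norm (a - b))\<^sup>2 = 1" using n1 ip that by simp
    then show ?thesis by (metis norm_ge_zero power2_eq_1_iff abs_of_nonneg abs_minus_cancel abs_one)
  qed
  define S' where "S' = insert y ((\<lambda>a. y + Y a) ` S)"
  have inj: "inj_on (\<lambda>a. y + Y a) S"
    using d by (intro inj_onI) (metis dist_eq_0_iff norm_eq_zero eq_iff_diff_eq_0)
  have "y \<notin> (\<lambda>a. y + Y a) ` S"
  proof
    assume "y \<in> (\<lambda>a. y + Y a) ` S"
    then obtain a where a: "a \<in> S" "Y a = 0" by auto
    then show False using nrm[of a] n1[of a] by simp
  qed
  then have "card S' = k"
    using S inj k by (simp add: S'_def card_image)
  moreover have "dist u v = 1" if "u \<in> S'" "v \<in> S'" "u \<noteq> v" for u v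
  proof -
    have "dist y (y + Y a) = 1" "dist (y + Y a) y = 1" if "a \<in> S" for a
      using n1[OF that] nrm[of a] by (simp_all add: dist_norm)
    moreover have "dist (y + Y a) (y + Y b) = 1" if "a \<in> S" "b \<in> S" "y + Y a \<noteq> y + Y b" for a b
      using d dist1 that by metis
    ultimately show ?thesis using that unfolding S'_def by auto
  qed
  ultimately have "unit_simplex k S'"
    using S by (simp add: unit_simplex_def S'_def)
  moreover have "S' \<subseteq> P" using S y by (auto simp: S'_def)
  ultimately show False using avoid by (auto simp: avoids_unit_simplices_def)
qed

text \<open>The image under \<open>sgn\<close> of this measure underlies
  \<open>sphere_measure\<close>. Averages over directions are taken of functions of
  \<open>sgn z\<close>, which avoids integrating against a restricted and completed measure; the
  exceptional point 0 is null.\<close>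

definition ball_measure :: "(real^'n) measure" where
  "ball_measure = uniform_measure lborel (ball 0 1)"

lemma sets_ball_measure [measurable_cong]: "sets ball_measure = sets borel"
  by (simp add: ball_measure_def)

lemma space_ball_measure [simp]: "space ball_measure = UNIV"
  by (simp add: ball_measure_def)

lemma emeasure_unit_ball:
  "emeasure lborel (ball 0 1 :: (real^'n) set) \<noteq> 0" "emeasure lborel (ball 0 1 :: (real^'n) set) \<noteq> \<infinity>"
  using emeasure_bounded_finite[of "ball 0 1 :: (real^'n) set"] content_ball_pos[of 1 "0 :: real^'n"]
  by (auto simp: measure_def)

lemma prob_space_ball_measure: "prob_space ball_measure"
  unfolding ball_measure_def by (rule prob_space_uniform_measure) (rule emeasure_unit_ball)+

lemma AE_ball_measure_nonzero: "AE z in (ball_measure :: (real^'n) measure). z \<noteq> 0"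
proof -
  have "AE z in lborel. z \<noteq> (0 :: real^'n)" by (rule AE_lborel_singleton)
  then show ?thesis
    unfolding ball_measure_def by (intro AE_uniform_measureI) (auto elim: eventually_mono)
qed

lemma measure_sphere_ball:
  fixes A :: "(real^'n) set"
  assumes [measurable]: "A \<in> sets borel" and "A \<subseteq> sphere 0 1"
  shows "measure ball_measure (sgn -` A) = measure sphere_measure A"
proof -
  have "sgn -` A \<in> sets borel"
    using measurable_sets[OF borel_measurable_sgn assms(1)] by simp
  then have "emeasure ball_measure (sgn -` A) = emeasure sphere_measure A"
    unfolding ball_measure_def using assms by (simp add: emeasure_sphere_measure(2))
  then show ?thesis by (simp add: measure_def)
qed

context periodic_set
begin

lemma measure_link_le:
  fixes Y :: "real^'n \<Rightarrow> real^'n"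
  assumes avoid: "avoids_unit_simplices k P" and k: "k \<ge> 1"
    and y: "y \<in> P" and Y: "orthogonal_transformation Y"
  shows "(\<integral>z. ind (y + Y (sgn z)) \<partial>ball_measure) \<le> alpha_sphere TYPE('n) (k - 1) (1 / 2)"
proof -
  let ?A = "{\<xi>\<in>sphere 0 1. y + Y \<xi> \<in> P}"
  have lin: "linear Y" using Y by (simp add: orthogonal_transformation_def)
  have [measurable]: "Y \<in> borel_measurable borel"
    using lin by (intro borel_measurable_continuous_onI linear_continuous_on) (simp add: linear_conv_bounded_linear)
  have A [measurable]: "?A \<in> sets borel" by measurable
  have "(\<integral>z. ind (y + Y (sgn z)) \<partial>ball_measure) = (\<integral>z. indicator (sgn -` ?A) z \<partial>ball_measure)"
  proof (rule integral_cong_AE)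
    show "AE z in ball_measure. ind (y + Y (sgn z)) = indicator (sgn -` ?A) z"
      using AE_ball_measure_nonzero by eventually_elim (auto simp: indicator_def norm_sgn)
    have "sgn -` ?A \<in> sets borel" using measurable_sets[OF borel_measurable_sgn A] by simp
    then show "indicator (sgn -` ?A) \<in> borel_measurable ball_measure"
      by (intro borel_measurable_indicator) (simp add: sets_ball_measure)
  qed measurable
  also have "\<dots> = measure sphere_measure ?A"
    by (subst measure_sphere_ball[OF A, symmetric]) auto
  also have "\<dots> \<le> alpha_sphere TYPE('n) (k - 1) (1 / 2)"
    by (rule alpha_sphere_upper[OF _ avoids_unit_simplices_link[OF avoid k y Y]])
      (rule emeasure_sphere_measure(1)[OF A], auto)
  finally show ?thesis .
qed

text \<open>Exchanging the two averages fixes \<open>y\<close> first. Points outside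
  \<open>P\<close> contribute nothing and points of \<open>P\<close> at most the spherical bound, so
  the measure of \<open>P\<close> appears as the factor that the normalisation cancels.\<close>

lemma sphere_mean_corr_le:
  fixes Y :: "real^'n \<Rightarrow> real^'n"
  assumes avoid: "avoids_unit_simplices k P" and k: "k \<ge> 1" and Y: "orthogonal_transformation Y"
  shows "(\<integral>z. corr (Y (sgn z)) \<partial>ball_measure) \<le> p * alpha_sphere TYPE('n) (k - 1) (1 / 2)"
proof -
  interpret B: prob_space "ball_measure :: (real^'n) measure" by (rule prob_space_ball_measure)
  interpret BT: pair_prob_space "ball_measure :: (real^'n) measure" "torus L :: (real^'n) measure" ..
  let ?\<alpha> = "alpha_sphere TYPE('n) (k - 1) (1 / 2)"
  have lin: "linear Y" using Y by (simp add: orthogonal_transformation_def)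
  have [measurable]: "Y \<in> borel_measurable borel"
    using lin by (intro borel_measurable_continuous_onI linear_continuous_on) (simp add: linear_conv_bounded_linear)
  have "(\<integral>z. corr (Y (sgn z)) \<partial>ball_measure) = (\<integral>z. (\<integral>y. ind y * ind (y + Y (sgn z)) \<partial>torus L) \<partial>ball_measure)"
    unfolding corr_def ..
  also have "\<dots> = (\<integral>y. (\<integral>z. ind y * ind (y + Y (sgn z)) \<partial>ball_measure) \<partial>torus L)"
    by (rule BT.Fubini_integral[symmetric], rule BT.integrable_const_bound[of _ 1]) (auto simp: indicator_def)
  also have "\<dots> \<le> (\<integral>y. ind y * ?\<alpha> \<partial>torus L)"
  proof (rule integral_mono)
    show "integrable (torus L) (\<lambda>y. ind y * ?\<alpha>)"
      by (rule integrable_torus_bounded[of _ "\<bar>?\<alpha>\<bar>"]) (auto simp: indicator_def)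
    show "integrable (torus L) (\<lambda>y. \<integral>z. ind y * ind (y + Y (sgn z)) \<partial>ball_measure)"
    proof (rule integrable_torus_bounded[of _ 1])
      show "\<bar>\<integral>z. ind y * ind (y + Y (sgn z)) \<partial>ball_measure\<bar> \<le> 1" for y
        using B.abs_integral_diff_const_le[OF B.integrable_const_bound[of "\<lambda>z. ind y * ind (y + Y (sgn z))" 1], of 0 1]
        by (simp add: indicator_def)
    qed (rule B.borel_measurable_lebesgue_integral, measurable)
    show "(\<integral>z. ind y * ind (y + Y (sgn z)) \<partial>ball_measure) \<le> ind y * ?\<alpha>" for y
      using measure_link_le[OF avoid k _ Y, of y] by (cases "y \<in> P") auto
  qed
  also have "\<dots> = p * ?\<alpha>" by (simp add: p_def)
  finally show ?thesis .
qed

text \<open>By radiality the value at \<open>x\<close> is also the average over all directions.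
  Exchanging this average with the one over matrices reduces the claim to one isometry at a time;
  the distribution of \<open>gs_apply M x\<close> on the sphere is never computed.\<close>

lemma rcorr_unit_le:
  assumes avoid: "avoids_unit_simplices k P" and k: "k \<ge> 1" and x: "norm x = 1"
  shows "rcorr x \<le> p * alpha_sphere TYPE('n) (k - 1) (1 / 2)"
proof -
  interpret B: prob_space "ball_measure :: (real^'n) measure" by (rule prob_space_ball_measure)
  interpret BF: pair_prob_space "ball_measure :: (real^'n) measure" "frame_measure :: (real^'n^'n) measure" ..
  have "measure (ball_measure :: (real^'n) measure) UNIV = 1"
    using B.prob_space by simp
  then have "rcorr x = (\<integral>z. rcorr x \<partial>(ball_measure :: (real^'n) measure))" by simp
  also have "\<dots> = (\<integral>z. rcorr (sgn z) \<partial>ball_measure)"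
  proof (rule integral_cong_AE)
    show "AE z in ball_measure. rcorr x = rcorr (sgn z)"
      using AE_ball_measure_nonzero
    proof eventually_elim
      case (elim z)
      then show ?case
        using radial_rcorr x unfolding radial_def by (metis norm_sgn)
    qed
  qed measurable
  also have "\<dots> = (\<integral>M. (\<integral>z. corr (gs_apply M (sgn z)) \<partial>ball_measure) \<partial>frame_measure)"
    unfolding rcorr_def
    by (rule BF.Fubini_integral[symmetric], rule BF.integrable_const_bound[of _ 1]) (auto simp: corr_bounds)
  also have "\<dots> \<le> p * alpha_sphere TYPE('n) (k - 1) (1 / 2)"
  proof (rule frame.integral_le_const)
    show "AE M in frame_measure. (\<integral>z. corr (gs_apply M (sgn z)) \<partial>ball_measure) \<le> p * alpha_sphere TYPE('n) (k - 1) (1 / 2)"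
      using AE_frame_measure by eventually_elim (rule sphere_mean_corr_le[OF avoid k gs_apply_isometry])
    show "integrable frame_measure (\<lambda>M. \<integral>z. corr (gs_apply M (sgn z)) \<partial>ball_measure)"
    proof (rule frame.integrable_const_bound[of _ 1])
      show "AE M in frame_measure. norm (\<integral>z. corr (gs_apply M (sgn z)) \<partial>ball_measure) \<le> 1"
      proof (rule AE_I2)
        fix M :: "real^'n^'n"
        show "norm (\<integral>z. corr (gs_apply M (sgn z)) \<partial>ball_measure) \<le> 1"
          using B.abs_integral_diff_const_le[OF B.integrable_const_bound[of "\<lambda>z. corr (gs_apply M (sgn z))" 1], of 0 1]
          by (simp add: corr_bounds)
      qed
    qed (rule B.borel_measurable_lebesgue_integral, measurable)
  qed
  finally show ?thesis .
qed

end

section \<open>From a compact set to an admissible function\<close>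

lemma positive_type_scale:
  fixes f :: "real^'n \<Rightarrow> real"
  assumes "positive_type f" "a \<ge> 0"
  shows "positive_type (\<lambda>x. f x * a)"
  unfolding positive_type_def
proof (intro allI impI conjI ballI)
  fix U :: "(real^'n) set" and x y :: "real^'n" assume "finite U" "x \<in> U" "y \<in> U"
  then show "f (x - y) * a = f (y - x) * a"
    using assms(1) unfolding positive_type_def by metis
next
  fix U :: "(real^'n) set" and c :: "real^'n \<Rightarrow> real" assume "finite U"
  then have "0 \<le> (\<Sum>x\<in>U. \<Sum>y\<in>U. c x * c y * f (x - y))"
    using assms(1) unfolding positive_type_def by blast
  then have "0 \<le> (\<Sum>x\<in>U. \<Sum>y\<in>U. c x * c y * f (x - y)) * a"
    using assms(2) by simp
  then show "0 \<le> (\<Sum>x\<in>U. \<Sum>y\<in>U. c x * c y * (f (x - y) * a))"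
    by (simp add: sum_distrib_right mult.assoc)
qed

text \<open>The set is the sum of a compact and a closed set; for two merely closed sets closedness
  could fail.\<close>

lemma closed_lattice_translates:
  fixes K :: "(real^'n) set"
  assumes "compact K" shows "closed {x. \<exists>v\<in>lattice L. x - v \<in> K}"
proof -
  have "{x. \<exists>v\<in>lattice L. x - v \<in> K} = (\<Union>x\<in>K. \<Union>y\<in>lattice L. {x + y})"
    (is "?A = ?B")
  proof
    show "?A \<subseteq> ?B"
    proof
      fix x assume "x \<in> ?A"
      then obtain v where v: "v \<in> lattice L" "x - v \<in> K" by blast
      have "x \<in> {x - v + v}" by simp
      then show "x \<in> ?B" using v by blast
    qed
    show "?B \<subseteq> ?A" by (auto intro: bexI[rotated])
  qed
  then show ?thesis
    using compact_closed_sums[OF assms closed_lattice, of L] by simp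
qed

text \<open>Translates of the cube of half-width \<open>T\<close> by distinct vectors of the lattice are more
  than unit distance apart, so a unit simplex in the periodic set lies in a single translate.\<close>

lemma avoids_lattice_translates:
  fixes K :: "(real^'n) set"
  assumes K: "K \<subseteq> cube T" and T: "T > 0" and avoid: "avoids_unit_simplices k K" and k: "k \<ge> 1"
  shows "avoids_unit_simplices k {x. \<exists>v\<in>lattice (2 * T + 2). x - v \<in> K}"
  unfolding avoids_unit_simplices_def
proof
  let ?\<Lambda> = "lattice (2 * T + 2) :: (real^'n) set"
  assume "\<exists>S\<subseteq>{x. \<exists>v\<in>?\<Lambda>. x - v \<in> K}. unit_simplex k S"
  then obtain S where S: "S \<subseteq> {x. \<exists>v\<in>?\<Lambda>. x - v \<in> K}" and simp: "unit_simplex k S" by blast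
  then have "\<forall>x\<in>S. \<exists>v. v \<in> ?\<Lambda> \<and> x - v \<in> K" by blast
  then obtain w where w: "\<And>x. x \<in> S \<Longrightarrow> w x \<in> ?\<Lambda>" "\<And>x. x \<in> S \<Longrightarrow> x - w x \<in> K"
    by (metis bchoice)
  have same: "w x = w y" if "x \<in> S" "y \<in> S" for x y
  proof -
    have dist: "norm (x - y) \<le> 1"
      using simp that by (cases "x = y") (auto simp: unit_simplex_def dist_norm)
    have "w x - w y \<in> ?\<Lambda>" using w that by (intro diff_lattice) auto
    then have "\<exists>m::int. (w x - w y) $ i = (2 * T + 2) * of_int m" for i
      by (simp add: lattice_def)
    then obtain m :: "'n \<Rightarrow> int" where m: "\<And>i. (w x - w y) $ i = (2 * T + 2) * of_int (m i)"
      by metis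
    have "m i = 0" for i
    proof (rule ccontr)
      assume "m i \<noteq> 0"
      then have "\<bar>real_of_int (m i)\<bar> \<ge> 1" by linarith
      \<comment> \<open>A nonzero lattice difference moves some coordinate by at least
        \<open>2 * T + 2\<close>, while two points of the cube and a distance of 1 account for at
        most \<open>2 * T + 1\<close>.\<close>
      then have "2 * T + 2 \<le> \<bar>(w x - w y) $ i\<bar>"
        unfolding m abs_mult using T by simp
      moreover have "\<bar>(x - w x) $ i\<bar> \<le> T" "\<bar>(y - w y) $ i\<bar> \<le> T"
        using w(2)[OF that(1)] w(2)[OF that(2)] K by (auto simp only: cube_nth subset_iff)
      moreover have "\<bar>(x - y) $ i\<bar> \<le> 1"
        using component_le_norm_cart[of "x - y" i] dist by linarith
      ultimately show False by simp
    qed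
    then have "w x - w y = 0" using m by (simp add: vec_eq_iff)
    then show ?thesis by simp
  qed
  have "S \<noteq> {}" using simp k by (auto simp: unit_simplex_def)
  then obtain x0 where x0: "x0 \<in> S" by blast
  have "unit_simplex k ((\<lambda>x. x - w x0) ` S)"
    using simp by (auto simp: unit_simplex_def card_image inj_on_def dist_norm)
  moreover have "(\<lambda>x. x - w x0) ` S \<subseteq> K"
    using w(2) same[OF _ x0] by force
  ultimately show False using avoid by (auto simp: avoids_unit_simplices_def)
qed

text \<open>The function \<open>rcorr\<close> has value \<open>p\<close> at 0 and mean
  \<open>p\<^sup>2\<close>, so division by \<open>p\<close> leaves mean \<open>p\<close>, the share
  of a period filled by \<open>K\<close>. The division is why \<open>K\<close> must have positive
  measure.\<close>

lemma witness_of_compact: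
  fixes K :: "(real^'n) set" and \<gamma> :: real
  assumes K: "compact K" "K \<subseteq> cube T" and T: "T > 0"
    and avoid: "avoids_unit_simplices k K" and k: "k \<ge> 1"
    and pos: "measure lborel K > 0" and \<gamma>: "\<gamma> \<ge> alpha_sphere TYPE('n) (k - 1) (1 / 2)"
  shows "\<exists>f :: real^'n \<Rightarrow> real. continuous_on UNIV f \<and> radial f \<and> positive_type f \<and>
        f 0 = 1 \<and> (\<forall>x. norm x = 1 \<longrightarrow> f x \<le> \<gamma>) \<and>
        mean_value f = measure lborel K / (2 * T + 2) ^ CARD('n)"
proof -
  define L where "L = 2 * T + 2"
  define P where "P = {x :: real^'n. \<exists>v\<in>lattice L. x - v \<in> K}"
  have L: "L > 0" using T by (simp add: L_def)
  interpret periodic_set L P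
  proof
    show "closed P" unfolding P_def by (rule closed_lattice_translates[OF K(1)])
    fix x v :: "real^'n" assume v: "v \<in> lattice L"
    show "x + v \<in> P \<longleftrightarrow> x \<in> P"
    proof
      assume "x + v \<in> P"
      then obtain w where "w \<in> lattice L" "x - (w - v) \<in> K" by (auto simp: P_def algebra_simps)
      then show "x \<in> P" using diff_lattice[of w L v] v by (auto simp: P_def)
    next
      assume "x \<in> P"
      then obtain w where w: "w \<in> lattice L" "x - w \<in> K" by (auto simp: P_def)
      then have "w - - v \<in> lattice L" "x + v - (w - - v) \<in> K"
        using diff_lattice[OF w(1) uminus_lattice[OF v]] by auto
      then show "x + v \<in> P" unfolding P_def by blast
    qed
  qed (rule L)
  \<comment> \<open>Half the period is \<open>T + 1\<close>, strictly more than \<open>T\<close>, so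
    the half-open sides of the cell cut nothing off \<open>K\<close>.\<close>
  have cell: "x \<in> cell L" if "x \<in> K" for x
  proof -
    have "\<bar>x $ i\<bar> \<le> T" for i using that K(2) by (auto simp: cube_nth)
    then have "- L / 2 \<le> x $ i \<and> x $ i < L / 2" for i
    proof -
      have "\<bar>x $ i\<bar> \<le> T" by fact
      then show ?thesis by (auto simp: L_def)
    qed
    then show ?thesis by (simp add: cell_def)
  qed
  \<comment> \<open>No other copy of \<open>K\<close> enters the cell: if \<open>x\<close> and
    \<open>x - v\<close> both lie in it, uniqueness in the tiling forces
    \<open>v = 0\<close>.\<close>
  have PK: "cell L \<inter> P = K"
  proof
    show "K \<subseteq> cell L \<inter> P"
      using cell zero_lattice[of L] by (force simp: P_def)
    show "cell L \<inter> P \<subseteq> K"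
    proof
      fix x assume "x \<in> cell L \<inter> P"
      then obtain v where v: "x \<in> cell L" "v \<in> lattice L" "x - v \<in> K" unfolding P_def by blast
      have "v = 0"
      proof (rule ex1E[OF cell_tiling[OF L, of x]])
        fix w assume w: "\<forall>u. u \<in> lattice L \<and> x - u \<in> cell L \<longrightarrow> u = w"
        have "v = w" by (rule w[rule_format], rule conjI[OF v(2) cell[OF v(3)]])
        moreover have "0 = w" by (rule w[rule_format], rule conjI[OF zero_lattice]) (simp add: v(1))
        ultimately show "v = 0" by (rule trans[OF _ sym])
      qed
      then show "x \<in> K" using v by simp
    qed
  qed
  have p_eq: "p = measure lborel K / L ^ CARD('n)"
    unfolding p_def torus_def using L
    by (subst measure_uniform_measure) (simp_all add: measure_cell PK)
  then have p_pos: "p > 0" using pos L by simp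
  define f where "f x = rcorr x * (1 / p)" for x
  have f_le: "f x \<le> \<gamma>" if x: "norm x = 1" for x
  proof -
    have "avoids_unit_simplices k P"
      unfolding P_def L_def by (rule avoids_lattice_translates[OF K(2) T avoid k])
    from rcorr_unit_le[OF this k x] have "rcorr x \<le> p * \<gamma>"
      using \<gamma> p_pos by (meson mult_left_mono less_imp_le order_trans)
    then show ?thesis using p_pos by (simp add: f_def field_simps)
  qed
  have cont: "continuous_on UNIV f"
    unfolding f_def by (intro continuous_intros continuous_rcorr)
  have "mean_value f = p\<^sup>2 * (1 / p)"
  proof (rule mean_valueI)
    show "f \<in> borel_measurable borel" by (rule borel_measurable_continuous_onI[OF cont])
    have "((\<lambda>T. (\<integral>x. rcorr x \<partial>cube_measure T) * (1 / p)) \<longlongrightarrow> p\<^sup>2 * (1 / p)) at_top"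
      by (intro tendsto_intros mean_limit_rcorr)
    then show "((\<lambda>T. \<integral>x. f x \<partial>cube_measure T) \<longlongrightarrow> p\<^sup>2 * (1 / p)) at_top"
      by (simp add: f_def)
  qed
  also have "\<dots> = measure lborel K / (2 * T + 2) ^ CARD('n)"
    using p_pos p_eq by (simp add: power2_eq_square L_def)
  finally have "mean_value f = measure lborel K / (2 * T + 2) ^ CARD('n)" .
  moreover have "radial f"
    using radial_rcorr unfolding radial_def f_def by metis
  moreover have "positive_type f"
    unfolding f_def by (rule positive_type_scale[OF positive_type_rcorr]) (use p_pos in simp)
  moreover have "f 0 = 1" using p_pos by (simp add: f_def rcorr_0)
  ultimately show ?thesis using cont f_le by blast
qed

section \<open>Compact subsets that nearly attain the upper density\<close>

lemma avoids_unit_simplices_subset: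
  "avoids_unit_simplices k B \<Longrightarrow> A \<subseteq> B \<Longrightarrow> avoids_unit_simplices k A"
  unfolding avoids_unit_simplices_def by blast

text \<open>Inner regularity supplies a closed subset, and boundedness of \<open>B\<close> makes it
  compact. Being Borel, it has the same measure under \<open>lebesgue\<close> and
  \<open>lborel\<close>.\<close>

lemma compact_subset_measure_gt:
  fixes B :: "'a::euclidean_space set"
  assumes B: "B \<in> sets lebesgue" "bounded B" and c: "c < measure lebesgue B"
  obtains K where "compact K" "K \<subseteq> B" "c < measure lborel K"
proof -
  define e where "e = measure lebesgue B - c"
  have "e > 0" using c by (simp add: e_def)
  then obtain K where K: "closed K" "K \<subseteq> B" "B - K \<in> lmeasurable" "emeasure lebesgue (B - K) < ennreal e"
    using sets_lebesgue_inner_closed[OF B(1)] by metis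
  have comp: "compact K" using K B(2) bounded_subset compact_eq_bounded_closed by blast
  have "B \<in> lmeasurable" using B by (simp add: bounded_set_imp_lmeasurable)
  then have "measure lebesgue (B - K) = measure lebesgue B - measure lebesgue K"
    using comp K by (intro measurable_measure_Diff) (auto intro: lmeasurable_compact)
  moreover have "measure lebesgue (B - K) < e"
    using K(3,4) by (simp add: emeasure_eq_measure2 fmeasurableD2 ennreal_less_iff)
  ultimately have "c < measure lebesgue K" by (simp add: e_def)
  moreover have "measure lebesgue K = measure lborel K"
    using comp by (simp add: measure_completion borel_compact)
  ultimately show ?thesis using that comp K by simp
qed

text \<open>The period \<open>2 * T + 2\<close> exceeds the side \<open>2 * T\<close> of the cube,
  which costs a factor \<open>(1 + 1 / T) ^ CARD('n)\<close>. It tends to 1, so the gap between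
  \<open>c\<close> and the upper density pays for it.\<close>

lemma exists_compact_density:
  fixes I :: "(real^'n) set"
  assumes I: "I \<in> sets lebesgue" and c: "0 \<le> c" "ereal c < upper_density I"
  obtains T K where "T > 0" "compact K" "K \<subseteq> I \<inter> cube T" "c < measure lborel K / (2 * T + 2) ^ CARD('n)"
proof -
  \<comment> \<open>The number \<open>d\<close> separates two demands on \<open>T\<close>: the
    margin factor must keep \<open>c\<close> below \<open>d\<close>, and the share of
    \<open>I\<close> in the cube must exceed \<open>d\<close>.\<close>
  obtain d where d: "c < d" "ereal d < upper_density I"
    using ereal_dense2[OF c(2)] by auto
  have "((\<lambda>T::real. 1 + 1 / T) \<longlongrightarrow> 1 + 0) at_top"
    by (intro tendsto_intros tendsto_divide_0[OF tendsto_const] filterlim_at_top_imp_at_infinity filterlim_ident)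
  then have "((\<lambda>T::real. c * (1 + 1 / T) ^ CARD('n)) \<longlongrightarrow> c * (1 + 0) ^ CARD('n)) at_top"
    by (intro tendsto_mult tendsto_power tendsto_const)
  then have ev: "eventually (\<lambda>T::real. c * (1 + 1 / T) ^ CARD('n) < d) at_top"
    by (rule order_tendstoD) (use d in simp)
  let ?r = "\<lambda>T. measure lebesgue (I \<inter> cube T) / measure lebesgue (cube T :: (real^'n) set)"
  have "\<exists>T. T > 0 \<and> c * (1 + 1 / T) ^ CARD('n) < d \<and> d < ?r T"
  proof (rule ccontr)
    assume "\<not> ?thesis"
    then have no: "\<not> d < ?r T" if "T > 0" "c * (1 + 1 / T) ^ CARD('n) < d" for T using that by blast
    \<comment> \<open>If no \<open>T\<close> met both demands, the share would be at most
      \<open>d\<close> for all large \<open>T\<close>, and then so would the limit superior.\<close>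
    have "eventually (\<lambda>T. ereal (?r T) \<le> ereal d) at_top"
      using ev eventually_gt_at_top[of 0] by eventually_elim (use no in \<open>auto simp: not_less\<close>)
    then have "upper_density I \<le> ereal d"
      unfolding upper_density_def by (rule Limsup_bounded)
    then show False using d(2) by simp
  qed
  then obtain T where T: "T > 0" "c * (1 + 1 / T) ^ CARD('n) < d" "d < ?r T" by blast
  have mc: "measure lebesgue (cube T :: (real^'n) set) = (2 * T) ^ CARD('n)"
    using T(1) measure_cube[of T, where 'n='n] by (simp add: measure_completion)
  have "c * (2 * T + 2) ^ CARD('n) = c * (1 + 1 / T) ^ CARD('n) * (2 * T) ^ CARD('n)"
  proof -
    have "2 * T + 2 = (1 + 1 / T) * (2 * T)" using T(1) by (simp add: field_simps)
    then show ?thesis by (simp only: power_mult_distrib mult.assoc)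
  qed
  also have "\<dots> < measure lebesgue (I \<inter> cube T)"
  proof -
    have "c * (1 + 1 / T) ^ CARD('n) < measure lebesgue (I \<inter> cube T) / (2 * T) ^ CARD('n)"
      using T(2,3) by (simp only: mc)
    then show ?thesis using T(1) by (simp add: pos_less_divide_eq)
  qed
  finally have "c * (2 * T + 2) ^ CARD('n) < measure lebesgue (I \<inter> cube T)" .
  moreover have "I \<inter> cube T \<in> sets lebesgue" using I by (auto simp: cube_def)
  moreover have "bounded (I \<inter> cube T)" by (auto simp: cube_def)
  ultimately obtain K where K: "compact K" "K \<subseteq> I \<inter> cube T" "c * (2 * T + 2) ^ CARD('n) < measure lborel K"
    using compact_subset_measure_gt by blast
  show ?thesis
    by (rule that[OF T(1) K(1,2)]) (use K(3) T(1) in \<open>simp add: pos_less_divide_eq\<close>)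
qed

theorem theorem3p1:
  fixes k :: nat and \<gamma> :: real
  assumes "CARD('n::finite) \<ge> 2"
    and "k \<ge> 3"
    and "k \<le> CARD('n) + 1"
    and "\<gamma> \<ge> 0"
    and "\<gamma> \<ge> alpha_sphere TYPE('n) (k - 1) (1 / 2)"
  shows "alpha_space TYPE('n) k \<le>
    (SUP f \<in> {f :: real^'n \<Rightarrow> real.
        continuous_on UNIV f \<and> radial f \<and> positive_type f \<and>
        f 0 = 1 \<and> (\<forall>x. norm x = 1 \<longrightarrow> f x \<le> \<gamma>)}. ereal (mean_value f))"
    (is "_ \<le> ?S")
proof -
  have k: "k \<ge> 1" using assms(2) by simp
  have lower: "ereal (measure lborel K / (2 * T + 2) ^ CARD('n)) \<le> ?S"
    if "compact K" "K \<subseteq> cube T" "T > 0" "avoids_unit_simplices k K" "measure lborel K > 0"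
    for K :: "(real^'n) set" and T
  proof -
    note K = that
    obtain f :: "real^'n \<Rightarrow> real" where f: "continuous_on UNIV f \<and> radial f \<and> positive_type f \<and>
        f 0 = 1 \<and> (\<forall>x. norm x = 1 \<longrightarrow> f x \<le> \<gamma>)"
      and m: "mean_value f = measure lborel K / (2 * T + 2) ^ CARD('n)"
      using witness_of_compact[OF K(1-4) k K(5) assms(5)] by auto
    have "ereal (mean_value f) \<le> ?S" by (rule SUP_upper) (use f in simp)
    then show ?thesis by (simp add: m)
  qed
  \<comment> \<open>With a nonnegative supremum, any \<open>c\<close> above it is nonnegative, so
    the compact set found below has positive measure and yields a witness.\<close>
  have S0: "0 \<le> ?S"
  proof -
    \<comment> \<open>The diameter 2/3 is less than 1, so this ball contains no two points at unit
      distance.\<close>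
    let ?K = "cball 0 (1 / 3) :: (real^'n) set"
    have "\<bar>x $ i\<bar> \<le> 1" if "x \<in> ?K" for x :: "real^'n" and i
      using component_le_norm_cart[of x i] that by simp
    then have "?K \<subseteq> cube 1" by (auto simp: cube_nth)
    moreover have "avoids_unit_simplices k ?K"
      unfolding avoids_unit_simplices_def
    proof
      assume "\<exists>S\<subseteq>?K. unit_simplex k S"
      then obtain S where S: "S \<subseteq> ?K" "unit_simplex k S" by blast
      then have "\<not> is_singleton S" "S \<noteq> {}" using assms(2)
        by (auto simp: unit_simplex_def is_singleton_altdef)
      then obtain x y where xy: "x \<in> S" "y \<in> S" "x \<noteq> y" by (metis is_singletonI' )
      then have "dist x y = 1" using S by (auto simp: unit_simplex_def)
      moreover have "norm x \<le> 1 / 3" "norm y \<le> 1 / 3" using xy S by auto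
      ultimately show False
        using norm_triangle_ineq4[of x y] by (simp add: dist_norm)
    qed
    moreover have "measure lborel ?K > 0" by (rule content_cball_pos) simp
    ultimately have "ereal (measure lborel ?K / (2 * 1 + 2) ^ CARD('n)) \<le> ?S"
      by (intro lower) auto
    moreover have "0 \<le> ereal (measure lborel ?K / (2 * 1 + 2) ^ CARD('n))" by simp
    ultimately show ?thesis by (rule order_trans[rotated])
  qed
  show ?thesis
    unfolding alpha_space_def
  proof (rule SUP_least)
    fix I :: "(real^'n) set"
    assume I: "I \<in> {I. I \<in> sets lebesgue \<and> avoids_unit_simplices k I}"
    show "upper_density I \<le> ?S"
    proof (rule ccontr)
      assume "\<not> upper_density I \<le> ?S"
      then have "?S < upper_density I" by (simp only: not_le)
      \<comment> \<open>A real number strictly between the two sides gives the density lemma a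
        finite target; the witness then has mean value above \<open>c\<close>, a
        contradiction.\<close>
      from ereal_dense2[OF this] obtain c where c: "?S < ereal c" "ereal c < upper_density I"
        by (elim exE conjE)
      have "0 \<le> ereal c" by (rule order_trans[OF S0 less_imp_le[OF c(1)]])
      then have "0 \<le> c" by simp
      obtain T K where TK: "T > 0" "compact K" "K \<subseteq> I \<inter> cube T"
        "c < measure lborel K / (2 * T + 2) ^ CARD('n)"
        by (rule exists_compact_density[OF _ \<open>0 \<le> c\<close> c(2)]) (use I in blast)
      have "measure lborel K > 0"
        using TK(4) \<open>0 \<le> c\<close> by (cases "measure lborel K = 0") (auto simp: less_le)
      then have "ereal (measure lborel K / (2 * T + 2) ^ CARD('n)) \<le> ?S"
        using TK I by (intro lower) (auto intro: avoids_unit_simplices_subset)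
      moreover have "ereal c \<le> ereal (measure lborel K / (2 * T + 2) ^ CARD('n))"
        using TK(4) by simp
      ultimately have "ereal c \<le> ?S" by (rule order_trans[rotated])
      from leD[OF this] c(1) show False by (rule notE)
    qed
  qed
qed

end
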